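(* Let $q\in[0,1]$ and let $\mathcal R_q$ be the unequal crossover recombinator with parameter $q$. Let $0<\alpha\le\delta<\infty$ and let $p(0)\in P_{\alpha,\delta}$. Then $p(t)\in P_{\alpha,\delta}$ for all $t\in\mathbb N_0$ for the discrete-time dynamics $p(t+1)=\mathcal R_q(p(t))$, respectively for all $t\in[0,\infty)$ for the continuous-time dynamics $\frac{d}{dt}p(t)=\mathcal R_q(p(t))-p(t)$. Moreover, $\mathcal R_q$ has a fixed point in $P_{\alpha,\delta}$.
   Context: $\mathcal M_1^+$ is the set of probability measures on $\mathbb N_0$, identified with nonnegative sequences $p=(p_k)_{k\ge0}$ summing to $1$, inside $\ell^1(\mathbb N_0)$ with norm $\|x\|_1=\sum_k|x_k|$. For $q\in[0,1]$ the transition probabilities are $$T^{(q)}_{ij,k\ell}=C^{(q)}_{k\ell}\,\delta_{i+j,k+\ell}\,(1+\min\{k,\ell,i,j\})\,q^{\max\{0,\ \min\{k,\ell\}-\min\{i,j\}\}},\qquad i,j,k,\ell\in\mathbb N_0,$$ with the convention $0^0=1$, where $C^{(q)}_{k\ell}>0$ is chosen so that $\sum_{i,j\ge0}T^{(q)}_{ij,k\ell}=1$ for all $k,\ell$. The recombinator is $\mathcal R_q(x)_i=\frac{1}{\|x\|_1}\sum_{j,k,\ell\ge0}T^{(q)}_{ij,k\ell}\,x_k x_\ell$ for $x\in\ell^1(\mathbb N_0)\setminus\{0\}$. For $p\in\mathcal M_1^+$ define $a(p)_k=\frac{1}{k+1}\sum_{\ell\ge k}\binom{\ell}{k}p_\ell\in[0,\infty]$,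 $k\in\mathbb N_0$. For $0<\alpha\le\delta<\infty$, $X_{\alpha,\delta}$ is the set of real sequences $a=(a_k)_{k\ge0}$ with $a_0=1$, $a_1=\alpha$ and $0\le a_k\le\delta^k$ for $k\ge2$, and $P_{\alpha,\delta}=\{p\in\mathcal M_1^+: a(p)\in X_{\alpha,\delta}\}$. A fixed point of $\mathcal R_q$ is $p$ with $\mathcal R_q(p)=p$. *)

theory Defs
  imports "HOL-Analysis.Analysis"
begin

definition l1 :: "(nat \<Rightarrow> real) set" where
  "l1 = {x. summable (\<lambda>k. \<bar>x k\<bar>)}"

definition norm1 :: "(nat \<Rightarrow> real) \<Rightarrow> real" where
  "norm1 x = (\<Sum>k. \<bar>x k\<bar>)"

definition M1plus :: "(nat \<Rightarrow> real) set" where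
  "M1plus = {p. (\<forall>k. 0 \<le> p k) \<and> p sums 1}"

text \<open>Unnormalised weights; the exponent uses truncated nat subtraction, i.e.
  max 0 (min k l - min i j); Isabelle has 0^0 = 1.\<close>
definition ucw :: "real \<Rightarrow> nat \<Rightarrow> nat \<Rightarrow> nat \<Rightarrow> nat \<Rightarrow> real" where
  "ucw q i j k l =
     (if i + j = k + l
      then real (1 + min (min k l) (min i j)) * q ^ (max 0 (min k l - min i j))
      else 0)"

definition ucC :: "real \<Rightarrow> nat \<Rightarrow> nat \<Rightarrow> real" where
  "ucC q k l = 1 / (\<Sum>\<^sub>\<infinity>(i,j)\<in>UNIV. ucw q i j k l)"

definition ucT :: "real \<Rightarrow> nat \<Rightarrow> nat \<Rightarrow> nat \<Rightarrow> nat \<Rightarrow> real" where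
  "ucT q i j k l = ucC q k l * ucw q i j k l"

definition recomb :: "real \<Rightarrow> (nat \<Rightarrow> real) \<Rightarrow> (nat \<Rightarrow> real)" where
  "recomb q x i = (1 / norm1 x) * (\<Sum>\<^sub>\<infinity>(j,k,l)\<in>UNIV. ucT q i j k l * x k * x l)"

text \<open>a(p)_k in [0,\<infinity>] (extended reals; terms are nonnegative).\<close>
definition acoef :: "(nat \<Rightarrow> real) \<Rightarrow> nat \<Rightarrow> ereal" where
  "acoef p k = ereal (1 / real (k + 1)) *
     (\<Sum>l. ereal (if k \<le> l then real (l choose k) * p l else 0))"

definition Xad :: "real \<Rightarrow> real \<Rightarrow> (nat \<Rightarrow> real) set" where
  "Xad \<alpha> \<delta> = {a. a 0 = 1 \<and> a 1 = \<alpha> \<and> (\<forall>k\<ge>2. 0 \<le> a k \<and> a k \<le> \<delta> ^ k)}"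

definition Pad :: "real \<Rightarrow> real \<Rightarrow> (nat \<Rightarrow> real) set" where
  "Pad \<alpha> \<delta> = {p \<in> M1plus. \<exists>a \<in> Xad \<alpha> \<delta>. \<forall>k. acoef p k = ereal (a k)}"

definition has_l1_deriv_on_halfline ::
  "(real \<Rightarrow> nat \<Rightarrow> real) \<Rightarrow> (nat \<Rightarrow> real) \<Rightarrow> real \<Rightarrow> bool" where
  "has_l1_deriv_on_halfline p D t \<longleftrightarrow>
     ((\<lambda>s. norm1 (\<lambda>k. (p s k - p t k) / (s - t) - D k)) \<longlongrightarrow> 0) (at t within {0..})"

end

theory Submission
  imports Defs "HOL-Complex_Analysis.Great_Picard"
begin

text \<open>
  For \<open>q = 1\<close> the offspring \<open>i\<close> of \<open>(k, l)\<close> is distributed as a sum of independent uniform variables on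
  \<open>{0..k}\<close> and \<open>{0..l}\<close>, which gives \<open>(m + 1) a(R p) m = (\<Sum>n\<le>m. a n * a (m - n))\<close> with \<open>a = a(p)\<close>.
  For \<open>q < 1\<close> the law is reweighted by an increasing function of \<open>min i j\<close>, whereas
  \<open>(i choose m) + (j choose m)\<close> decreases in \<open>min i j\<close>; by Chebyshev's sum inequality the identity
  becomes \<open>\<le>\<close>, and \<open>a n \<le> \<delta> ^ n\<close> is preserved. Mass and mean are preserved exactly.

  In continuous time, \<open>Pad \<alpha> \<delta>\<close> is convex, closed and mapped into itself by the \<open>l1\<close>-Lipschitz map
  \<open>recomb q\<close>, so the distance of a solution to it satisfies a Gronwall inequality and vanishes.

  A fixed point is a limit of fixed points of kernels truncated to \<open>{0..N}\<close>, which exist by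
  Brouwer's theorem. The limit satisfies \<open>recomb q p \<le> p\<close> by Fatou, with equality since both have
  mass 1. As \<open>N\<close> varies, Brouwer's theorem is needed with the dimension as a number rather than a type,
  so it is derived from Kuhn's lemma.
\<close>

subsection \<open>Brouwer's theorem for sequence cubes\<close>

lemma tendsto_fun_iff:
  fixes X :: "'a \<Rightarrow> 'i \<Rightarrow> 'b::topological_space"
  shows "(X \<longlongrightarrow> x) F \<longleftrightarrow> (\<forall>i. ((\<lambda>m. X m i) \<longlongrightarrow> x i) F)"
proof -
  have "(X \<longlongrightarrow> x) F \<longleftrightarrow> limitin (product_topology (\<lambda>i. euclidean) UNIV) X x F"
    by (simp add: euclidean_product_topology)
  also have "\<dots> \<longleftrightarrow> (\<forall>i. ((\<lambda>m. X m i) \<longlongrightarrow> x i) F)"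
    by (subst limitin_componentwise) auto
  finally show ?thesis .
qed

definition nat_cube :: "nat \<Rightarrow> (nat \<Rightarrow> real) set" where
  "nat_cube n = {x. (\<forall>i<n. 0 \<le> x i \<and> x i \<le> 1) \<and> (\<forall>i\<ge>n. x i = 0)}"

lemma kuhn_sign_change:
  fixes f :: "(nat \<Rightarrow> real) \<Rightarrow> nat \<Rightarrow> real"
  assumes f01: "\<And>x i. x \<in> nat_cube n \<Longrightarrow> i < n \<Longrightarrow> 0 \<le> f x i \<and> f x i \<le> 1"
    and m: "0 < m"
  shows "\<exists>z. z \<in> nat_cube n \<and> (\<forall>i<n. \<exists>r s. r \<in> nat_cube n \<and> s \<in> nat_cube n \<and>
           (\<forall>j. \<bar>r j - z j\<bar> \<le> 1 / real m \<and> \<bar>s j - z j\<bar> \<le> 1 / real m) \<and>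
           r i \<le> f r i \<and> f s i \<le> s i)"
proof -
  define v where "v x = (\<lambda>j. if j < n then real (x j) / real m else 0)" for x :: "nat \<Rightarrow> nat"
  define label where
    "label x i = (if x i \<noteq> m \<and> v x i \<le> f (v x) i then 0 else 1 :: nat)" for x i
  have v_cube: "v x \<in> nat_cube n" if "\<forall>i<n. x i \<le> m" for x
    using that m by (auto simp: v_def nat_cube_def)
  have v_0: "v x i \<le> f (v x) i" if "\<forall>i<n. x i \<le> m" "i < n" "label x i = 0" for x i
    using that by (auto simp: label_def split: if_splits)
  have v_1: "f (v x) i \<le> v x i" if "\<forall>i<n. x i \<le> m" "i < n" "label x i \<noteq> 0" for x i
    using that f01[OF v_cube, of x i] m by (auto simp: label_def v_def split: if_splits)
  obtain z where z: "\<forall>i<n. z i < m"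
    and zrs: "\<forall>i<n. \<exists>r s. (\<forall>j<n. z j \<le> r j \<and> r j \<le> z j + 1) \<and>
        (\<forall>j<n. z j \<le> s j \<and> s j \<le> z j + 1) \<and> label r i \<noteq> label s i"
  proof (rule kuhn_lemma[of m n label])
    show "\<forall>x. (\<forall>i<n. x i \<le> m) \<longrightarrow> (\<forall>i<n. x i = 0 \<longrightarrow> label x i = 0)"
      using f01[OF v_cube] m by (auto simp: label_def v_def)
  qed (use m in \<open>auto simp: label_def\<close>)
  have close: "\<bar>v x j - v z j\<bar> \<le> 1 / real m" if "\<forall>j<n. z j \<le> x j \<and> x j \<le> z j + 1" for x j
    using that m by (auto simp: v_def diff_divide_distrib[symmetric] divide_le_cancel)
  have le_m: "\<forall>i<n. x i \<le> m" if "\<forall>j<n. z j \<le> x j \<and> x j \<le> z j + 1" for x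
    using that z by (metis Suc_eq_plus1 Suc_leI le_trans)
  show ?thesis
  proof (rule exI[of _ "v z"], intro conjI allI impI)
    show "v z \<in> nat_cube n"
      using z by (intro v_cube) (simp add: less_imp_le)
    fix i assume i: "i < n"
    obtain r s where r: "\<forall>j<n. z j \<le> r j \<and> r j \<le> z j + 1"
      and s: "\<forall>j<n. z j \<le> s j \<and> s j \<le> z j + 1" and rs: "label r i \<noteq> label s i"
      using zrs i by blast
    have "label r i = 0 \<and> label s i \<noteq> 0 \<or> label s i = 0 \<and> label r i \<noteq> 0"
      using rs by (auto simp: label_def split: if_splits)
    then show "\<exists>r s. r \<in> nat_cube n \<and> s \<in> nat_cube n \<and>
           (\<forall>j. \<bar>r j - v z j\<bar> \<le> 1 / real m \<and> \<bar>s j - v z j\<bar> \<le> 1 / real m) \<and>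
           r i \<le> f r i \<and> f s i \<le> s i"
    proof
      assume "label r i = 0 \<and> label s i \<noteq> 0"
      then show ?thesis
        using r s i by (intro exI[of _ "v r"] exI[of _ "v s"]) (simp add: v_cube le_m close v_0 v_1)
    next
      assume "label s i = 0 \<and> label r i \<noteq> 0"
      then show ?thesis
        using r s i by (intro exI[of _ "v s"] exI[of _ "v r"]) (simp add: v_cube le_m close v_0 v_1)
    qed
  qed
qed

theorem brouwer_nat_cube:
  fixes f :: "(nat \<Rightarrow> real) \<Rightarrow> nat \<Rightarrow> real"
  assumes f01: "\<And>x i. x \<in> nat_cube n \<Longrightarrow> i < n \<Longrightarrow> 0 \<le> f x i \<and> f x i \<le> 1"
    and cont: "\<And>i. i < n \<Longrightarrow> continuous_on (nat_cube n) (\<lambda>x. f x i)"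
  obtains x where "x \<in> nat_cube n" "\<And>i. i < n \<Longrightarrow> f x i = x i"
proof -
  have "\<exists>z. z \<in> nat_cube n \<and> (\<forall>i<n. \<exists>r s. r \<in> nat_cube n \<and> s \<in> nat_cube n \<and>
      (\<forall>j. \<bar>r j - z j\<bar> \<le> 1 / real (Suc m) \<and> \<bar>s j - z j\<bar> \<le> 1 / real (Suc m)) \<and>
      r i \<le> f r i \<and> f s i \<le> s i)" for m
    by (rule kuhn_sign_change[OF f01]) auto
  then obtain z where z: "\<And>m. z m \<in> nat_cube n"
    and "\<forall>m. \<forall>i<n. \<exists>r s. r \<in> nat_cube n \<and> s \<in> nat_cube n \<and>
      (\<forall>j. \<bar>r j - z m j\<bar> \<le> 1 / real (Suc m) \<and> \<bar>s j - z m j\<bar> \<le> 1 / real (Suc m)) \<and>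
      r i \<le> f r i \<and> f s i \<le> s i"
    by metis
  then obtain r s where rs_cube: "\<And>m i. i < n \<Longrightarrow> r m i \<in> nat_cube n \<and> s m i \<in> nat_cube n"
    and rs_close: "\<And>m i j. i < n \<Longrightarrow> \<bar>r m i j - z m j\<bar> \<le> 1 / real (Suc m) \<and>
        \<bar>s m i j - z m j\<bar> \<le> 1 / real (Suc m)"
    and rs_sign: "\<And>m i. i < n \<Longrightarrow> r m i i \<le> f (r m i) i \<and> f (s m i) i \<le> s m i i"
    by metis
  have "norm (z m j) \<le> 1" for m j
    using z[of m] by (cases "j < n") (auto simp: nat_cube_def)
  then obtain k where k: "strict_mono k" and "\<And>j. \<exists>l. (\<lambda>m. z (k m) j) \<longlonglongrightarrow> l"
    by - (rule function_convergent_subsequence[of UNIV z 1], auto)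
  then obtain x where x: "\<And>j. (\<lambda>m. z (k m) j) \<longlonglongrightarrow> x j"
    by metis
  have x_cube: "x \<in> nat_cube n"
  proof -
    have "0 \<le> x i" "x i \<le> 1" if "i < n" for i
      by (rule LIMSEQ_le_const[OF x] LIMSEQ_le_const2[OF x]; use z that in \<open>auto simp: nat_cube_def\<close>)+
    moreover have "x i = 0" if "i \<ge> n" for i
      using LIMSEQ_unique[OF x[of i], of 0] z that by (auto simp: nat_cube_def)
    ultimately show ?thesis
      by (auto simp: nat_cube_def)
  qed
  have eps: "(\<lambda>m. 1 / real (Suc (k m))) \<longlonglongrightarrow> 0"
    using LIMSEQ_subseq_LIMSEQ[OF lim_1_over_n[THEN LIMSEQ_Suc] k] by (simp add: o_def)
  have lim: "(\<lambda>m. y (k m)) \<longlonglongrightarrow> x" and flim: "(\<lambda>m. f (y (k m)) i) \<longlonglongrightarrow> f x i"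
    if "\<And>m j. \<bar>y m j - z m j\<bar> \<le> 1 / real (Suc m)" "\<And>m. y m \<in> nat_cube n" "i < n" for y i
  proof -
    have diff: "(\<lambda>m. y (k m) j - z (k m) j) \<longlonglongrightarrow> 0" for j
      by (rule Lim_null_comparison[OF _ eps]) (use that in auto)
    have "(\<lambda>m. y (k m) j) \<longlonglongrightarrow> x j" for j
      using tendsto_add[OF diff[of j] x[of j]] by simp
    then show *: "(\<lambda>m. y (k m)) \<longlonglongrightarrow> x"
      by (simp add: tendsto_fun_iff)
    show "(\<lambda>m. f (y (k m)) i) \<longlonglongrightarrow> f x i"
      using continuous_on_tendsto_compose[OF cont[OF that(3)] * x_cube] that by simp
  qed
  have "f x i = x i" if i: "i < n" for i
  proof (rule antisym)
    show "f x i \<le> x i"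
      using lim[of "\<lambda>m. s m i" i] flim[of "\<lambda>m. s m i" i] rs_close rs_cube rs_sign i
      by (intro LIMSEQ_le[of "\<lambda>m. f (s (k m) i) i" _ "\<lambda>m. s (k m) i i"]) (auto simp: tendsto_fun_iff)
    show "x i \<le> f x i"
      using lim[of "\<lambda>m. r m i" i] flim[of "\<lambda>m. r m i" i] rs_close rs_cube rs_sign i
      by (intro LIMSEQ_le[of "\<lambda>m. r (k m) i i" _ "\<lambda>m. f (r (k m) i) i"]) (auto simp: tendsto_fun_iff)
  qed
  with x_cube show ?thesis
    by (rule that)
qed

subsection \<open>Crossover weights\<close>

lemma chebyshev_sum_weighted:
  fixes w h F :: "'a \<Rightarrow> real"
  assumes w: "\<And>i. i \<in> A \<Longrightarrow> 0 \<le> w i"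
    and opp: "\<And>i j. i \<in> A \<Longrightarrow> j \<in> A \<Longrightarrow> (h i - h j) * (F i - F j) \<le> 0"
  shows "(\<Sum>i\<in>A. w i * h i * F i) * (\<Sum>i\<in>A. w i) \<le> (\<Sum>i\<in>A. w i * h i) * (\<Sum>i\<in>A. w i * F i)"
proof -
  have "(\<Sum>i\<in>A. \<Sum>j\<in>A. w i * w j * ((h i - h j) * (F i - F j))) \<le> 0"
    by (intro sum_nonpos mult_nonneg_nonpos opp mult_nonneg_nonneg w)
  also have "(\<Sum>i\<in>A. \<Sum>j\<in>A. w i * w j * ((h i - h j) * (F i - F j))) =
      (\<Sum>i\<in>A. \<Sum>j\<in>A. (w i * h i * F i) * w j) + (\<Sum>i\<in>A. \<Sum>j\<in>A. w i * (w j * h j * F j))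
      - (\<Sum>i\<in>A. \<Sum>j\<in>A. (w i * h i) * (w j * F j)) - (\<Sum>i\<in>A. \<Sum>j\<in>A. (w i * F i) * (w j * h j))"
    by (simp add: sum.distrib[symmetric] sum_subtractf[symmetric] algebra_simps)
  also have "\<dots> = 2 * ((\<Sum>i\<in>A. w i * h i * F i) * (\<Sum>i\<in>A. w i)
      - (\<Sum>i\<in>A. w i * h i) * (\<Sum>i\<in>A. w i * F i))"
    by (simp add: sum_product[symmetric])
  finally show ?thesis by simp
qed

text \<open>The weight is the number of ways to write \<open>i = a + b\<close> with \<open>a \<le> k\<close>, \<open>b \<le> l\<close>, so for \<open>q = 1\<close>
  the law of \<open>i\<close> is the convolution of the uniform laws on \<open>{0..k}\<close> and \<open>{0..l}\<close>.\<close>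
lemma sum_min_weight:
  fixes f :: "nat \<Rightarrow> real"
  shows "(\<Sum>i\<le>k+l. real (1 + min (min k l) (min i (k + l - i))) * f i) =
    (\<Sum>a\<le>k. \<Sum>b\<le>l. f (a + b))"
proof -
  have card: "card {x \<in> {..k} \<times> {..l}. fst x + snd x = i} = 1 + min (min k l) (min i (k + l - i))"
    if "i \<le> k + l" for i
  proof -
    have "{x \<in> {..k} \<times> {..l}. fst x + snd x = i} = (\<lambda>a. (a, i - a)) ` {i - l..min k i}"
      by (auto simp: image_iff)
    then have "card {x \<in> {..k} \<times> {..l}. fst x + snd x = i} = card {i - l..min k i}"
      by (simp add: card_image inj_on_def)
    then show ?thesis
      using that by (auto simp: min_def)
  qed
  have "(\<Sum>i\<le>k+l. real (1 + min (min k l) (min i (k + l - i))) * f i) =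
      (\<Sum>i\<le>k+l. \<Sum>x | x \<in> {..k} \<times> {..l} \<and> fst x + snd x = i. f (fst x + snd x))"
    by (intro sum.cong) (auto simp: card simp del: of_nat_add of_nat_Suc)
  also have "\<dots> = (\<Sum>x\<in>{..k} \<times> {..l}. f (fst x + snd x))"
    by (intro sum.group) auto
  also have "\<dots> = (\<Sum>a\<le>k. \<Sum>b\<le>l. f (a + b))"
    by (simp add: sum.cartesian_product case_prod_unfold)
  finally show ?thesis .
qed

lemma sum_choose_uniform:
  "(\<Sum>a\<le>k. real (a choose n)) = real (k + 1) * (real (k choose n) / real (n + 1))"
proof -
  have "(\<Sum>a\<le>k. real (a choose n)) = real (Suc k choose Suc n)"
    unfolding of_nat_sum[symmetric] by (rule arg_cong, rule sum_choose_upper)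
  also have "\<dots> = real (k + 1) * (real (k choose n) / real (n + 1))"
    using arg_cong[OF Suc_times_binomial_eq[of k n], of real] by (simp add: field_simps del: binomial_Suc_Suc)
  finally show ?thesis .
qed

lemma sum_choose_convolution:
  "(\<Sum>a\<le>k. \<Sum>b\<le>l. real ((a + b) choose m)) = real (k + 1) * real (l + 1) *
    (\<Sum>n\<le>m. (real (k choose n) / real (n + 1)) * (real (l choose (m - n)) / real (m - n + 1)))"
proof -
  have "(\<Sum>a\<le>k. \<Sum>b\<le>l. real ((a + b) choose m)) =
      (\<Sum>a\<le>k. \<Sum>b\<le>l. \<Sum>n\<le>m. real (a choose n) * real (b choose (m - n)))"
    by (simp flip: vandermonde)
  also have "\<dots> = (\<Sum>a\<le>k. \<Sum>n\<le>m. \<Sum>b\<le>l. real (a choose n) * real (b choose (m - n)))"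
    by (intro sum.cong refl sum.swap)
  also have "\<dots> = (\<Sum>n\<le>m. \<Sum>a\<le>k. \<Sum>b\<le>l. real (a choose n) * real (b choose (m - n)))"
    by (rule sum.swap)
  also have "\<dots> = (\<Sum>n\<le>m. (\<Sum>a\<le>k. real (a choose n)) * (\<Sum>b\<le>l. real (b choose (m - n))))"
    by (simp add: sum_product)
  finally show ?thesis
    by (simp add: sum_choose_uniform sum_distrib_left mult_ac del: of_nat_add of_nat_Suc)
qed

lemma choose_pair_antimono:
  assumes "u \<le> v" "2 * v \<le> s"
  shows "(v choose m) + ((s - v) choose m) \<le> (u choose m) + ((s - u) choose m)"
  using assms
proof (induction v rule: dec_induct)
  case (step x)
  have "(Suc x choose m) + ((s - Suc x) choose m) \<le> (x choose m) + ((s - x) choose m)"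
  proof (cases m)
    case (Suc m')
    have "s - x = Suc (s - Suc x)"
      using step by simp
    moreover have "(x choose m') \<le> ((s - Suc x) choose m')"
      using step by (intro binomial_right_mono) simp
    ultimately show ?thesis
      using Suc by simp
  qed simp
  then show ?case
    using step by simp
qed simp

definition cross_weight :: "nat \<Rightarrow> nat \<Rightarrow> (nat \<Rightarrow> real) \<Rightarrow> nat \<Rightarrow> real" where
  "cross_weight k l g i = real (1 + min (min k l) (min i (k + l - i))) * g (min i (k + l - i))"

definition cross_ker :: "nat \<Rightarrow> nat \<Rightarrow> (nat \<Rightarrow> real) \<Rightarrow> nat \<Rightarrow> real" where
  "cross_ker k l g i =
    (if i \<le> k + l then cross_weight k l g i / (\<Sum>j\<le>k+l. cross_weight k l g j) else 0)"

lemma sum_reflect: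
  fixes f :: "nat \<Rightarrow> real"
  shows "(\<Sum>i\<le>s. f (s - i)) = (\<Sum>i\<le>s. f i)"
  by (rule sum.reindex_bij_witness[of _ "\<lambda>i. s - i" "\<lambda>i. s - i"]) auto

lemma cross_weight_reflect: "i \<le> k + l \<Longrightarrow> cross_weight k l g (k + l - i) = cross_weight k l g i"
  by (simp add: cross_weight_def min.commute)

lemma sum_cross_ker: "(\<Sum>i\<le>k+l. f i * cross_ker k l g i) =
    (\<Sum>i\<le>k+l. f i * cross_weight k l g i) / (\<Sum>i\<le>k+l. cross_weight k l g i)"
  by (simp add: cross_ker_def sum_divide_distrib)

lemma sum_cross_weight_symmetrize: "(\<Sum>i\<le>k+l. f i * cross_weight k l g i) =
    (\<Sum>i\<le>k+l. (f i + f (k + l - i)) * cross_weight k l g i) / 2"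
proof -
  have "(\<Sum>i\<le>k+l. f (k + l - i) * cross_weight k l g i) =
      (\<Sum>i\<le>k+l. f (k + l - i) * cross_weight k l g (k + l - i))"
    by (intro sum.cong) (auto simp: cross_weight_reflect)
  also have "\<dots> = (\<Sum>i\<le>k+l. f i * cross_weight k l g i)"
    by (rule sum_reflect)
  finally show ?thesis
    by (simp add: distrib_right sum.distrib)
qed

context
  fixes k l :: nat and g :: "nat \<Rightarrow> real"
  assumes g_nonneg: "\<And>u. 0 \<le> g u" and g_mono: "mono g" and g_pos: "0 < g (min k l)"
begin

lemma cross_weight_nonneg: "0 \<le> cross_weight k l g i"
  by (simp add: cross_weight_def g_nonneg)

lemma sum_cross_weight_pos: "0 < (\<Sum>i\<le>k+l. cross_weight k l g i)"
proof (rule sum_pos2[of _ k])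
  show "0 < cross_weight k l g k"
    using g_pos by (simp add: cross_weight_def add_pos_nonneg)
qed (simp_all add: cross_weight_nonneg)

lemma cross_ker_nonneg: "0 \<le> cross_ker k l g i"
  using sum_cross_weight_pos by (simp add: cross_ker_def cross_weight_nonneg)

lemma sum_cross_ker_1: "(\<Sum>i\<le>k+l. cross_ker k l g i) = 1"
  using sum_cross_ker[of "\<lambda>_. 1"] sum_cross_weight_pos by simp

lemma sum_cross_ker_mean: "(\<Sum>i\<le>k+l. real i * cross_ker k l g i) = real (k + l) / 2"
proof -
  have "(\<Sum>i\<le>k+l. real i * cross_weight k l g i) = 
      (\<Sum>i\<le>k+l. real (k + l) * cross_weight k l g i) / 2"
    unfolding sum_cross_weight_symmetrize[of real] by (simp flip: of_nat_add)
  then show ?thesis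
    using sum_cross_weight_pos unfolding sum_cross_ker by (simp add: sum_distrib_left[symmetric])
qed

end

text \<open>Chebyshev's sum inequality: both \<open>g\<close> and the symmetrised binomial are functions of
  \<open>min i (k + l - i)\<close>, the former increasing and the latter decreasing, so \<open>g = 1\<close> is the worst case.\<close>
lemma sum_cross_ker_choose_le:
  assumes g_nonneg: "\<And>u. 0 \<le> g u" and g_mono: "mono g" and g_pos: "0 < g (min k l)"
  shows "(\<Sum>i\<le>k+l. real (i choose m) * cross_ker k l g i) \<le>
    (\<Sum>n\<le>m. (real (k choose n) / real (n + 1)) * (real (l choose (m - n)) / real (m - n + 1)))"
    (is "_ \<le> ?S")
proof -
  define w where "w = cross_weight k l (\<lambda>_. 1)"
  define h where "h i = g (min i (k + l - i))" for i
  define \<phi> where "\<phi> u = real (u choose m) + real ((k + l - u) choose m)" for u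
  have cw: "cross_weight k l g i = w i * h i" for i
    by (simp add: cross_weight_def w_def h_def)
  have \<phi>: "\<phi> i = \<phi> (min i (k + l - i))" if "i \<le> k + l" for i
    using that by (auto simp: \<phi>_def min_def)
  have opp: "(h i - h j) * (\<phi> i - \<phi> j) \<le> 0" if "i \<le> k + l" "j \<le> k + l" for i j
  proof -
    define u v where "u = min i (k + l - i)" and "v = min j (k + l - j)"
    have uv: "2 * u \<le> k + l" "2 * v \<le> k + l"
      using that by (auto simp: u_def v_def)
    have 1: "\<phi> u \<le> \<phi> v \<and> g v \<le> g u" if "v \<le> u" "2 * u \<le> k + l" for u v
      using choose_pair_antimono[OF that, of m] monoD[OF g_mono that(1)]
      unfolding \<phi>_def of_nat_add[symmetric] of_nat_le_iff by simp
    have "(g u - g v) * (\<phi> u - \<phi> v) \<le> 0"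
      using 1[of u v] 1[of v u] uv by (cases "u \<le> v") (auto simp: mult_le_0_iff)
    then show ?thesis
      using that by (simp add: \<phi>[of i] \<phi>[of j] h_def u_def v_def)
  qed
  define S where "S = ?S"
  define K where "K = real (k + 1) * real (l + 1)"
  define X where "X = (\<Sum>i\<le>k+l. real (i choose m) * cross_weight k l g i)"
  define H where "H = (\<Sum>i\<le>k+l. cross_weight k l g i)"
  have "(\<Sum>i\<le>k+l. w i * h i * \<phi> i) * (\<Sum>i\<le>k+l. w i) \<le>
      (\<Sum>i\<le>k+l. w i * h i) * (\<Sum>i\<le>k+l. w i * \<phi> i)"
    by (rule chebyshev_sum_weighted) (auto simp: opp w_def cross_weight_def)
  moreover have "(\<Sum>i\<le>k+l. w i) = K"
    using sum_min_weight[of k l "\<lambda>_. 1"] by (simp add: w_def cross_weight_def mult.commute K_def)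
  moreover have "(\<Sum>i\<le>k+l. w i * h i * \<phi> i) = 2 * X"
    using sum_cross_weight_symmetrize[where k = k and l = l and g = g and f = "\<lambda>i. real (i choose m)"]
    by (simp add: cw \<phi>_def mult_ac X_def)
  moreover have "(\<Sum>i\<le>k+l. w i * h i) = H"
    by (simp add: H_def cw)
  moreover have "(\<Sum>i\<le>k+l. w i * \<phi> i) = 2 * (\<Sum>i\<le>k+l. real (i choose m) * w i)"
    using sum_cross_weight_symmetrize[where k = k and l = l and g = "\<lambda>_. 1" and f = "\<lambda>i. real (i choose m)"]
    by (simp add: w_def \<phi>_def mult_ac)
  moreover have "(\<Sum>i\<le>k+l. real (i choose m) * w i) = K * S"
    using sum_min_weight[of k l "\<lambda>i. real (i choose m)"]
    unfolding sum_choose_convolution w_def cross_weight_def K_def S_def by (simp add: mult_ac)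
  ultimately have "X * K \<le> (H * S) * K"
    by (simp add: mult_ac)
  then have "X \<le> H * S"
    by (rule mult_right_le_imp_le) (simp add: K_def)
  then show ?thesis
    unfolding sum_cross_ker using sum_cross_weight_pos[of g k l] assms
    by (simp add: divide_le_eq mult.commute X_def H_def S_def)
qed

subsection \<open>Moments\<close>

locale crossover_kernel =
  fixes K :: "nat \<Rightarrow> nat \<Rightarrow> nat \<Rightarrow> real"
  assumes K_nonneg: "0 \<le> K k l i"
    and K_supp: "k + l < i \<Longrightarrow> K k l i = 0"
    and K_sum: "(\<Sum>i\<le>k+l. K k l i) = 1"
    and K_mean: "(\<Sum>i\<le>k+l. real i * K k l i) = real (k + l) / 2"
    and K_choose: "(\<Sum>i\<le>k+l. real (i choose m) * K k l i) \<le>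
      (\<Sum>n\<le>m. (real (k choose n) / real (n + 1)) * (real (l choose (m - n)) / real (m - n + 1)))"

lemma crossover_kernel_cross_ker:
  assumes "\<And>k l u. 0 \<le> g k l u" "\<And>k l. mono (g k l)" "\<And>k l. 0 < g k l (min k l)"
  shows "crossover_kernel (\<lambda>k l. cross_ker k l (g k l))"
proof
  fix k l i m :: nat
  note [simp] = assms
  show "0 \<le> cross_ker k l (g k l) i"
    by (rule cross_ker_nonneg) simp_all
  show "(\<Sum>i\<le>k+l. cross_ker k l (g k l) i) = 1"
    by (rule sum_cross_ker_1) simp_all
  show "(\<Sum>i\<le>k+l. real i * cross_ker k l (g k l) i) = real (k + l) / 2"
    by (rule sum_cross_ker_mean) simp_all
  show "(\<Sum>i\<le>k+l. real (i choose m) * cross_ker k l (g k l) i) \<le>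
      (\<Sum>n\<le>m. (real (k choose n) / real (n + 1)) * (real (l choose (m - n)) / real (m - n + 1)))"
    by (rule sum_cross_ker_choose_le) simp_all
qed (simp add: cross_ker_def)

definition bilin :: "(nat \<Rightarrow> nat \<Rightarrow> nat \<Rightarrow> real) \<Rightarrow> (nat \<Rightarrow> real) \<Rightarrow> (nat \<Rightarrow> real) \<Rightarrow> nat \<Rightarrow> real" where
  "bilin K x y i = (\<Sum>\<^sub>\<infinity>(k,l)\<in>UNIV. K k l i * (x k * y l))"

lemma has_sum_mult_nonneg:
  fixes x :: "'a \<Rightarrow> real" and y :: "'b \<Rightarrow> real"
  assumes "(x has_sum a) UNIV" "(y has_sum b) UNIV" "\<And>k. 0 \<le> x k" "\<And>l. 0 \<le> y l"
  shows "((\<lambda>(k,l). x k * y l) has_sum a * b) UNIV"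
proof -
  have inner: "((\<lambda>l. case (k, l) of (k, l) \<Rightarrow> x k * y l) has_sum x k * b) UNIV" for k
    using has_sum_cmult_right[OF assms(2), of "x k"] by simp
  have outer: "((\<lambda>k. x k * b) has_sum a * b) UNIV"
    using has_sum_cmult_left[OF assms(1), of b] by simp
  have "((\<lambda>(k,l). x k * y l) has_sum a * b) (UNIV \<times> UNIV)"
  proof (rule has_sum_SigmaI[OF inner outer])
    show "(\<lambda>(k,l). x k * y l) summable_on UNIV \<times> UNIV"
      by (rule summable_on_SigmaI[OF inner]) (use assms outer in \<open>auto simp: summable_on_def\<close>)
  qed
  then show ?thesis by simp
qed

lemma has_sum_sum:
  fixes f :: "'a \<Rightarrow> 'b \<Rightarrow> real"
  assumes "\<And>n. n \<in> A \<Longrightarrow> (f n has_sum s n) B"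
  shows "((\<lambda>x. \<Sum>n\<in>A. f n x) has_sum (\<Sum>n\<in>A. s n)) B"
  using assms by (induction A rule: infinite_finite_induct) (auto intro: has_sum_add)

context crossover_kernel
begin

lemma K_has_sum: "((\<lambda>i. f i * K k l i) has_sum (\<Sum>i\<le>k+l. f i * K k l i)) UNIV"
  by (rule has_sum_finite_neutralI) (auto simp: K_supp)

lemma bilin_expectation:
  assumes nonneg: "\<And>i. 0 \<le> f i" "\<And>k. 0 \<le> x k" "\<And>l. 0 \<le> y l"
    and G: "((\<lambda>(k,l). (\<Sum>i\<le>k+l. f i * K k l i) * (x k * y l)) has_sum G) UNIV"
  shows "((\<lambda>i. f i * bilin K x y i) has_sum G) UNIV"
    and "f i \<noteq> 0 \<Longrightarrow> (\<lambda>(k,l). K k l i * (x k * y l)) summable_on UNIV"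
proof -
  define F where "F = (\<lambda>((k,l),i). f i * K k l i * (x k * y l))"
  have inner: "((\<lambda>i. F (kl, i)) has_sum
      (case kl of (k,l) \<Rightarrow> (\<Sum>i\<le>k+l. f i * K k l i) * (x k * y l))) UNIV" for kl
    using has_sum_cmult_left[OF K_has_sum] by (auto simp: F_def split: prod.split)
  have "F summable_on UNIV \<times> UNIV"
    by (rule summable_on_SigmaI[OF inner])
      (use G nonneg K_nonneg in \<open>auto simp: summable_on_def F_def\<close>)
  then have "(F has_sum G) (UNIV \<times> UNIV)"
    by (rule has_sum_SigmaI[OF inner G])
  then have swapped: "((\<lambda>(i,kl). F (kl,i)) has_sum G) (UNIV \<times> UNIV)"
    by (rule has_sum_swap[THEN iffD1])
  have inner': "(\<lambda>kl. F (kl, i)) summable_on UNIV" for i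
    by (rule summable_on_SigmaD1[of "\<lambda>i kl. F (kl, i)" UNIV "\<lambda>_. UNIV"])
      (use swapped in \<open>auto simp: summable_on_def\<close>)
  have F_i: "F (kl, i) = f i * (case kl of (k,l) \<Rightarrow> K k l i * (x k * y l))" for kl i
    by (simp add: F_def split: prod.split)
  have "((\<lambda>kl. F (kl, i)) has_sum (f i * bilin K x y i)) UNIV" for i
    using has_sum_infsum[OF inner'[of i]] unfolding F_i infsum_cmult_right' bilin_def .
  then show "((\<lambda>i. f i * bilin K x y i) has_sum G) UNIV"
    by (intro has_sum_SigmaD[OF swapped]) auto
  show "(\<lambda>(k,l). K k l i * (x k * y l)) summable_on UNIV" if "f i \<noteq> 0"
    using inner'[of i] that unfolding F_i by (simp add: summable_on_cmult_right')
qed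

lemma bilin_nonneg: "(\<And>k. 0 \<le> x k) \<Longrightarrow> (\<And>l. 0 \<le> y l) \<Longrightarrow> 0 \<le> bilin K x y i"
  unfolding bilin_def by (intro infsum_nonneg) (auto simp: K_nonneg)

lemma bilin_mass:
  assumes "\<And>k. 0 \<le> x k" "\<And>l. 0 \<le> y l" "(x has_sum a) UNIV" "(y has_sum b) UNIV"
  shows "(bilin K x y has_sum a * b) UNIV"
    and "(\<lambda>(k,l). K k l i * (x k * y l)) summable_on UNIV"
  using bilin_expectation[of "\<lambda>_. 1" x y "a * b"] has_sum_mult_nonneg[OF assms(3,4)] assms(1,2)
  by (simp_all add: K_sum)

lemma bilin_mean:
  assumes p: "\<And>k. 0 \<le> p k" "(p has_sum 1) UNIV" and mean: "((\<lambda>k. real k * p k) has_sum \<mu>) UNIV"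
  shows "((\<lambda>i. real i * bilin K p p i) has_sum \<mu>) UNIV"
proof (rule bilin_expectation)
  have "((\<lambda>kl. 1/2 * ((case kl of (k,l) \<Rightarrow> (real k * p k) * p l) +
      (case kl of (k,l) \<Rightarrow> p k * (real l * p l)))) has_sum 1/2 * (\<mu> * 1 + 1 * \<mu>)) UNIV"
    by (intro has_sum_cmult_right has_sum_add has_sum_mult_nonneg p mean) (simp_all add: p)
  then show "((\<lambda>(k,l). (\<Sum>i\<le>k+l. real i * K k l i) * (p k * p l)) has_sum \<mu>) UNIV"
    by (simp add: K_mean case_prod_unfold algebra_simps add_divide_distrib)
qed (simp_all add: p)

lemma bilin_choose:
  assumes p: "\<And>k. 0 \<le> p k" and M: "\<And>n. n \<le> m \<Longrightarrow> ((\<lambda>k. real (k choose n) * p k) has_sum M n) UNIV"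
  obtains G where "((\<lambda>i. real (i choose m) * bilin K p p i) has_sum G) UNIV"
    "G \<le> (\<Sum>n\<le>m. M n / real (n + 1) * (M (m - n) / real (m - n + 1)))"
proof -
  define u where "u = (\<lambda>n k. real (k choose n) / real (n + 1) * p k)"
  have u: "(u n has_sum M n / real (n + 1)) UNIV" if "n \<le> m" for n
    using has_sum_cmult_left[OF M[OF that], of "1 / real (n + 1)"] by (simp add: u_def field_simps)
  have bound: "((\<lambda>kl. \<Sum>n\<le>m. case kl of (k,l) \<Rightarrow> u n k * u (m - n) l) has_sum
      (\<Sum>n\<le>m. M n / real (n + 1) * (M (m - n) / real (m - n + 1)))) UNIV"
    by (intro has_sum_sum has_sum_mult_nonneg u) (auto simp: u_def p)
  let ?f = "\<lambda>kl. case kl of (k,l) \<Rightarrow> (\<Sum>i\<le>k+l. real (i choose m) * K k l i) * (p k * p l)"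
  have le: "?f kl \<le> (\<Sum>n\<le>m. case kl of (k,l) \<Rightarrow> u n k * u (m - n) l)" for kl
  proof (cases kl)
    case (Pair k l)
    have "?f kl \<le> (\<Sum>n\<le>m. (real (k choose n) / real (n + 1)) *
        (real (l choose (m - n)) / real (m - n + 1))) * (p k * p l)"
      unfolding Pair prod.case by (intro mult_right_mono K_choose mult_nonneg_nonneg p)
    also have "\<dots> = (\<Sum>n\<le>m. u n k * u (m - n) l)"
      unfolding u_def sum_distrib_right by (intro sum.cong) (simp_all only: mult_ac)
    finally show ?thesis
      by (simp add: Pair)
  qed
  have nonneg: "0 \<le> ?f kl" for kl
    by (auto split: prod.split intro!: mult_nonneg_nonneg sum_nonneg K_nonneg p)
  have "?f summable_on UNIV"
    by (rule summable_on_comparison_test[of _ UNIV]) (use bound le nonneg in \<open>auto simp: summable_on_def\<close>)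
  then obtain G where G: "(?f has_sum G) UNIV"
    by (auto simp: summable_on_def)
  show ?thesis
  proof (rule that)
    show "((\<lambda>i. real (i choose m) * bilin K p p i) has_sum G) UNIV"
      by (rule bilin_expectation) (use G p in auto)
    show "G \<le> (\<Sum>n\<le>m. M n / real (n + 1) * (M (m - n) / real (m - n + 1)))"
      by (rule has_sum_mono[OF G bound]) (rule le)
  qed
qed

end

subsection \<open>The recombinator on \<open>Pad\<close>\<close>

definition uc_ker :: "real \<Rightarrow> nat \<Rightarrow> nat \<Rightarrow> nat \<Rightarrow> real" where
  "uc_ker q k l = cross_ker k l (\<lambda>u. q ^ (min k l - u))"

lemma mono_power_diff: "0 \<le> q \<Longrightarrow> q \<le> 1 \<Longrightarrow> mono (\<lambda>u. (q::real) ^ (n - u))"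
  by (auto simp: mono_def intro: power_decreasing)

lemma crossover_kernel_uc_ker: "0 \<le> q \<Longrightarrow> q \<le> 1 \<Longrightarrow> crossover_kernel (uc_ker q)"
  unfolding uc_ker_def by (rule crossover_kernel_cross_ker) (auto simp: mono_power_diff)

lemma ucT_eq: "i + j = k + l \<Longrightarrow> ucT q i j k l = uc_ker q k l i"
proof -
  assume ij: "i + j = k + l"
  have w: "ucw q i (k + l - i) k l = cross_weight k l (\<lambda>u. q ^ (min k l - u)) i" if "i \<le> k + l" for i
    using that by (simp add: ucw_def cross_weight_def)
  have "(\<Sum>\<^sub>\<infinity>(i,j)\<in>UNIV. ucw q i j k l) = (\<Sum>\<^sub>\<infinity>(i,j)\<in>(\<lambda>i. (i, k + l - i)) ` {..k+l}. ucw q i j k l)"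
    by (rule infsum_cong_neutral) (auto simp: ucw_def image_iff)
  also have "\<dots> = (\<Sum>i\<le>k+l. ucw q i (k + l - i) k l)"
    by (simp add: sum.reindex inj_on_def)
  also have "\<dots> = (\<Sum>i\<le>k+l. cross_weight k l (\<lambda>u. q ^ (min k l - u)) i)"
    by (intro sum.cong) (auto simp: w)
  finally have C: "(\<Sum>\<^sub>\<infinity>(i,j)\<in>UNIV. ucw q i j k l) = \<dots>" .
  have "i \<le> k + l" "j = k + l - i"
    using ij by simp_all
  then show ?thesis
    by (simp add: ucT_def ucC_def C w uc_ker_def cross_ker_def)
qed

lemma recomb_eq_bilin: "recomb q x i = bilin (uc_ker q) x x i / norm1 x"
proof -
  let ?\<phi> = "\<lambda>(k,l). (k + l - i, k, l)"
  have img: "?\<phi> ` {(k,l). i \<le> k + l} = {(j,k,l). i + j = k + l}"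
    by (force simp: image_iff)
  have "(\<Sum>\<^sub>\<infinity>(j,k,l)\<in>UNIV. ucT q i j k l * x k * x l) =
      (\<Sum>\<^sub>\<infinity>(j,k,l)\<in>?\<phi> ` {(k,l). i \<le> k + l}. ucT q i j k l * x k * x l)"
    unfolding img by (rule infsum_cong_neutral) (auto simp: ucT_def ucw_def)
  also have "\<dots> = (\<Sum>\<^sub>\<infinity>(k,l)\<in>{(k,l). i \<le> k + l}. ucT q i (k + l - i) k l * x k * x l)"
    by (subst infsum_reindex) (auto simp: inj_on_def o_def case_prod_unfold)
  also have "\<dots> = (\<Sum>\<^sub>\<infinity>(k,l)\<in>UNIV. uc_ker q k l i * (x k * x l))"
    by (rule infsum_cong_neutral) (auto simp: ucT_eq uc_ker_def cross_ker_def)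
  finally show ?thesis
    by (simp add: recomb_def bilin_def)
qed

lemma suminf_ereal_eq_iff_sums:
  assumes "\<And>l. 0 \<le> f l"
  shows "(\<Sum>l. ereal (f l)) = ereal r \<longleftrightarrow> f sums r"
proof -
  have "summable (\<lambda>l. ereal (f l))"
    using assms by (intro summable_ereal_pos) simp
  then show ?thesis
    by (metis sums_ereal sums_iff)
qed

lemma has_sum_UNIV_iff_sums:
  fixes f :: "nat \<Rightarrow> real"
  assumes "\<And>l. 0 \<le> f l"
  shows "(f has_sum r) UNIV \<longleftrightarrow> f sums r"
  using assms has_sum_imp_sums sums_nonneg_imp_has_sum by blast

lemma acoef_eq_iff:
  assumes "\<And>l. 0 \<le> p l"
  shows "acoef p k = ereal a \<longleftrightarrow> ((\<lambda>l. real (l choose k) * p l) has_sum (real (k + 1) * a)) UNIV"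
proof -
  let ?S = "\<Sum>l. ereal (real (l choose k) * p l)"
  have "(\<lambda>l. ereal (if k \<le> l then real (l choose k) * p l else 0)) =
      (\<lambda>l. ereal (real (l choose k) * p l))"
    by auto
  then have "acoef p k = ereal (1 / real (k + 1)) * ?S"
    unfolding acoef_def by simp
  then have "acoef p k = ereal a \<longleftrightarrow> ?S = ereal (real (k + 1) * a)"
    by (cases ?S) (auto simp: field_simps)
  also have "\<dots> \<longleftrightarrow> ((\<lambda>l. real (l choose k) * p l) has_sum (real (k + 1) * a)) UNIV"
    using assms by (simp add: suminf_ereal_eq_iff_sums has_sum_UNIV_iff_sums)
  finally show ?thesis .
qed

lemma Pad_iff:
  assumes \<alpha>: "\<alpha> \<le> \<delta>"
  shows "p \<in> Pad \<alpha> \<delta> \<longleftrightarrow> (\<forall>k. 0 \<le> p k) \<and> (p has_sum 1) UNIV \<and>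
    ((\<lambda>k. real k * p k) has_sum 2 * \<alpha>) UNIV \<and>
    (\<forall>m. \<exists>M. ((\<lambda>k. real (k choose m) * p k) has_sum M) UNIV \<and> M \<le> real (m + 1) * \<delta> ^ m)"
    (is "_ \<longleftrightarrow> ?nn \<and> ?mass \<and> ?mean \<and> ?mom")
proof
  assume "p \<in> Pad \<alpha> \<delta>"
  then obtain a where nn: ?nn and mass: "p sums 1" and a: "a \<in> Xad \<alpha> \<delta>" and "\<forall>k. acoef p k = ereal (a k)"
    by (auto simp: Pad_def M1plus_def)
  then have m: "((\<lambda>l. real (l choose k) * p l) has_sum (real (k + 1) * a k)) UNIV" for k
    using acoef_eq_iff[of p] by blast
  have "a k \<le> \<delta> ^ k" for k
  proof -
    consider "k = 0" | "k = 1" | "k \<ge> 2" by linarith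
    then show ?thesis using a \<alpha> by cases (auto simp: Xad_def)
  qed
  then have ?mom
    using m by (metis mult_left_mono of_nat_0_le_iff)
  moreover have ?mean
    using m[of 1] a by (simp add: Xad_def)
  moreover have ?mass
    using nn mass by (simp add: has_sum_UNIV_iff_sums)
  ultimately show "?nn \<and> ?mass \<and> ?mean \<and> ?mom"
    using nn by blast
next
  assume *: "?nn \<and> ?mass \<and> ?mean \<and> ?mom"
  then obtain M where M: "\<And>m. ((\<lambda>k. real (k choose m) * p k) has_sum M m) UNIV"
      "\<And>m. M m \<le> real (m + 1) * \<delta> ^ m"
    by metis
  define a where "a m = M m / real (m + 1)" for m
  have M_nonneg: "0 \<le> M m" for m
    using has_sum_nonneg[OF M(1)] * by simp
  have "M 0 = 1" "M 1 = 2 * \<alpha>"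
    using has_sum_unique[OF M(1)[of 0], of 1] has_sum_unique[OF M(1)[of 1], of "2 * \<alpha>"] * by auto
  then have "a \<in> Xad \<alpha> \<delta>"
    using M(2) M_nonneg by (auto simp: Xad_def a_def field_simps)
  moreover have "\<forall>k. acoef p k = ereal (a k)"
    using * M(1) by (simp add: acoef_eq_iff a_def)
  moreover have "p \<in> M1plus"
    using * by (simp add: M1plus_def has_sum_imp_sums)
  ultimately show "p \<in> Pad \<alpha> \<delta>"
    by (auto simp: Pad_def)
qed

lemma (in crossover_kernel) bilin_Pad:
  assumes \<alpha>: "0 < \<alpha>" "\<alpha> \<le> \<delta>" and p: "p \<in> Pad \<alpha> \<delta>"
  shows "bilin K p p \<in> Pad \<alpha> \<delta>"
proof -
  have nn: "\<And>k. 0 \<le> p k" and mass: "(p has_sum 1) UNIV"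
    and mean: "((\<lambda>k. real k * p k) has_sum 2 * \<alpha>) UNIV"
    using p by (simp_all add: Pad_iff[OF \<alpha>(2)])
  obtain M where M: "\<And>m. ((\<lambda>k. real (k choose m) * p k) has_sum M m) UNIV"
      "\<And>m. M m \<le> real (m + 1) * \<delta> ^ m"
    using p unfolding Pad_iff[OF \<alpha>(2)] by metis
  have "\<exists>G. ((\<lambda>k. real (k choose m) * bilin K p p k) has_sum G) UNIV \<and> G \<le> real (m + 1) * \<delta> ^ m" for m
  proof -
    obtain G where G: "((\<lambda>i. real (i choose m) * bilin K p p i) has_sum G) UNIV"
      "G \<le> (\<Sum>n\<le>m. M n / real (n + 1) * (M (m - n) / real (m - n + 1)))"
      by (rule bilin_choose[of p m M]) (use nn M in auto)
    note G(2)
    also have "(\<Sum>n\<le>m. M n / real (n + 1) * (M (m - n) / real (m - n + 1))) \<le>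
        (\<Sum>n\<le>m. \<delta> ^ n * \<delta> ^ (m - n))"
    proof (intro sum_mono mult_mono)
      fix n
      have *: "M n / real (n + 1) \<le> \<delta> ^ n" for n
        using M(2)[of n] by (simp add: field_simps)
      show "M n / real (n + 1) \<le> \<delta> ^ n" "M (m - n) / real (m - n + 1) \<le> \<delta> ^ (m - n)"
        by (rule *)+
      show "0 \<le> \<delta> ^ n"
        using \<alpha> by simp
      show "0 \<le> M (m - n) / real (m - n + 1)"
        using has_sum_nonneg[OF M(1), of "m - n"] nn by simp
    qed
    also have "\<dots> = real (m + 1) * \<delta> ^ m"
      by (simp flip: power_add)
    finally show ?thesis
      using G(1) by blast
  qed
  then show ?thesis
    using bilin_nonneg[of p p] bilin_mass[OF nn nn mass mass] bilin_mean[OF nn mass mean] nn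
    by (simp add: Pad_iff[OF \<alpha>(2)])
qed

lemma norm1_Pad: "p \<in> Pad \<alpha> \<delta> \<Longrightarrow> norm1 p = 1"
  by (auto simp: Pad_def M1plus_def norm1_def sums_iff)

lemma Pad_subset_l1: "p \<in> Pad \<alpha> \<delta> \<Longrightarrow> p \<in> l1"
  by (auto simp: Pad_def M1plus_def l1_def sums_iff)

lemma recomb_Pad:
  assumes "0 \<le> q" "q \<le> 1" "0 < \<alpha>" "\<alpha> \<le> \<delta>" "p \<in> Pad \<alpha> \<delta>"
  shows "recomb q p \<in> Pad \<alpha> \<delta>"
proof -
  have "recomb q p = bilin (uc_ker q) p p"
    using norm1_Pad[OF assms(5)] by (simp add: fun_eq_iff recomb_eq_bilin)
  then show ?thesis
    using crossover_kernel.bilin_Pad[OF crossover_kernel_uc_ker] assms by metis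
qed

lemma Pad_convex:
  assumes "\<alpha> \<le> \<delta>" "x \<in> Pad \<alpha> \<delta>" "y \<in> Pad \<alpha> \<delta>" "0 \<le> s" "s \<le> 1"
  shows "(\<lambda>k. (1 - s) * x k + s * y k) \<in> Pad \<alpha> \<delta>"
proof -
  have lin: "((\<lambda>k. f k * ((1 - s) * x k + s * y k)) has_sum (1 - s) * a + s * b) UNIV"
    if "((\<lambda>k. f k * x k) has_sum a) UNIV" "((\<lambda>k. f k * y k) has_sum b) UNIV" for f a b
    using has_sum_add[OF has_sum_cmult_right[OF that(1), of "1 - s"] has_sum_cmult_right[OF that(2), of s]]
    by (simp add: algebra_simps)
  have "\<exists>M. ((\<lambda>k. real (k choose m) * ((1 - s) * x k + s * y k)) has_sum M) UNIV \<and>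
      M \<le> real (m + 1) * \<delta> ^ m" for m
  proof -
    obtain a where a: "((\<lambda>k. real (k choose m) * x k) has_sum a) UNIV" "a \<le> real (m + 1) * \<delta> ^ m"
      using assms(2) unfolding Pad_iff[OF assms(1)] by blast
    obtain b where b: "((\<lambda>k. real (k choose m) * y k) has_sum b) UNIV" "b \<le> real (m + 1) * \<delta> ^ m"
      using assms(3) unfolding Pad_iff[OF assms(1)] by blast
    have "(1 - s) * a + s * b \<le> (1 - s) * (real (m + 1) * \<delta> ^ m) + s * (real (m + 1) * \<delta> ^ m)"
      using assms a b by (intro add_mono mult_left_mono) auto
    also have "\<dots> = real (m + 1) * \<delta> ^ m"
      by (simp only: distrib_right[symmetric]) simp
    finally show ?thesis
      using lin[OF a(1) b(1)] by blast
  qed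
  moreover have "((\<lambda>k. (1 - s) * x k + s * y k) has_sum 1) UNIV"
    using lin[of "\<lambda>k. 1" 1 1] assms by (simp add: Pad_iff)
  moreover have "((\<lambda>k. real k * ((1 - s) * x k + s * y k)) has_sum 2 * \<alpha>) UNIV"
    using lin[of real "2 * \<alpha>" "2 * \<alpha>"] assms unfolding distrib_right[symmetric] by (simp add: Pad_iff)
  moreover have "0 \<le> (1 - s) * x k + s * y k" for k
    using assms by (simp add: Pad_iff)
  ultimately show ?thesis
    unfolding Pad_iff[OF assms(1)] by blast
qed

lemma sums_limit_of_tight:
  fixes y :: "nat \<Rightarrow> nat \<Rightarrow> real"
  assumes y: "\<And>n k. 0 \<le> y n k" "\<And>k. (\<lambda>n. y n k) \<longlonglongrightarrow> p k"
    and hg: "\<And>k. 0 \<le> h k" "\<And>k. 0 \<le> g k" "\<And>k N. N < k \<Longrightarrow> h k * real N \<le> g k"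
    and c: "\<And>n. (\<lambda>k. h k * y n k) sums c"
    and C: "\<And>n. \<exists>M\<le>C. (\<lambda>k. g k * y n k) sums M"
  shows "(\<lambda>k. h k * p k) sums c"
proof -
  have lim: "(\<lambda>n. \<Sum>k\<le>N. h k * y n k) \<longlonglongrightarrow> (\<Sum>k\<le>N. h k * p k)" for N
    by (intro tendsto_intros y)
  have upper: "(\<Sum>k\<le>N. h k * p k) \<le> c" for N
  proof (rule LIMSEQ_le_const2[OF lim], intro exI allI impI)
    fix n show "(\<Sum>k\<le>N. h k * y n k) \<le> c"
      using c[of n] sum_le_suminf[of "\<lambda>k. h k * y n k" "{..N}"] y hg by (simp add: sums_iff)
  qed
  have lower: "c - C / real (Suc N) \<le> (\<Sum>k\<le>Suc N. h k * p k)" for N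
  proof (rule LIMSEQ_le_const[OF lim], intro exI allI impI)
    fix n
    obtain M where M: "M \<le> C" "(\<lambda>k. g k * y n k) sums M"
      using C by blast
    have "(\<lambda>k. (if k \<in> {..Suc N} then h k * y n k else 0) + g k * y n k / real (Suc N))
        sums ((\<Sum>k\<le>Suc N. h k * y n k) + M / real (Suc N))"
      by (intro sums_add sums_If_finite_set sums_divide M) simp
    from _ c[of n] this have "c \<le> (\<Sum>k\<le>Suc N. h k * y n k) + M / real (Suc N)"
    proof (rule sums_le)
      fix k
      show "h k * y n k \<le> (if k \<in> {..Suc N} then h k * y n k else 0) + g k * y n k / real (Suc N)"
      proof (cases "k \<le> Suc N")
        case False
        then have "h k * real (Suc N) * y n k \<le> g k * y n k"
          by (intro mult_right_mono hg y) simp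
        then show ?thesis
          using False by (simp add: field_simps)
      qed (use y hg in simp)
    qed
    moreover have "M / real (Suc N) \<le> C / real (Suc N)"
      using M by (intro divide_right_mono) auto
    ultimately show "c - C / real (Suc N) \<le> (\<Sum>k\<le>Suc N. h k * y n k)"
      by simp
  qed
  have "(\<lambda>N. c - C / real (Suc N)) \<longlonglongrightarrow> c - 0"
    by (intro tendsto_intros LIMSEQ_Suc lim_const_over_n)
  then have "(\<lambda>N. c - C / real (Suc N)) \<longlonglongrightarrow> c"
    by (simp only: diff_0_right)
  then have "(\<lambda>N. \<Sum>k\<le>Suc N. h k * p k) \<longlonglongrightarrow> c"
    by (rule tendsto_sandwich[OF always_eventually[OF allI[OF lower]] always_eventually[OF allI[OF upper]]])
      (rule tendsto_const)
  then show ?thesis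
    unfolding sums_def_le by (rule LIMSEQ_imp_Suc)
qed

lemma Pad_closed:
  assumes \<alpha>: "\<alpha> \<le> \<delta>" and y: "\<And>n. y n \<in> Pad \<alpha> \<delta>" and lim: "\<And>k. (\<lambda>n. y n k) \<longlonglongrightarrow> p k"
  shows "p \<in> Pad \<alpha> \<delta>"
proof -
  have yn: "0 \<le> y n k" "(y n has_sum 1) UNIV" "((\<lambda>k. real k * y n k) has_sum 2 * \<alpha>) UNIV"
    "\<exists>M. ((\<lambda>k. real (k choose m) * y n k) has_sum M) UNIV \<and> M \<le> real (m + 1) * \<delta> ^ m" for n k m
    using y[of n] by (simp_all add: Pad_iff[OF \<alpha>])
  have p: "0 \<le> p k" for k
    by (rule LIMSEQ_le_const[OF lim]) (use yn in auto)
  have ch: "2 * real (k choose 2) = real k * (real k - 1)" for k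
    by (induction k) (auto simp: numeral_2_eq_2 algebra_simps)
  have C: "\<exists>M\<le>2 * (3 * \<delta> ^ 2). (\<lambda>k. (2 * real (k choose 2)) * y n k) sums M" for n
  proof -
    obtain M where M: "((\<lambda>k. real (k choose 2) * y n k) has_sum M) UNIV" "M \<le> 3 * \<delta> ^ 2"
      using yn(4)[of 2 n] by auto
    then show ?thesis
      using sums_mult[OF has_sum_imp_sums[OF M(1)], of 2] by (intro exI[of _ "2 * M"]) (simp add: mult.assoc)
  qed
  have mass: "(\<lambda>k. 1 * p k) sums 1"
  proof (rule sums_limit_of_tight[OF yn(1) lim _ _ _ _ C])
    fix k N :: nat assume "N < k"
    then have "1 * real N \<le> real k * (real k - 1)"
      by (intro mult_mono) auto
    then show "1 * real N \<le> 2 * real (k choose 2)"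
      by (simp add: ch)
  qed (use has_sum_imp_sums[OF yn(2)] in auto)
  have mean: "(\<lambda>k. real k * p k) sums (2 * \<alpha>)"
  proof (rule sums_limit_of_tight[OF yn(1) lim _ _ _ _ C])
    fix k N :: nat assume "N < k"
    then show "real k * real N \<le> 2 * real (k choose 2)"
      unfolding ch by (intro mult_left_mono) auto
  qed (use has_sum_imp_sums[OF yn(3)] in auto)
  have mom: "\<exists>M. ((\<lambda>k. real (k choose m) * p k) has_sum M) UNIV \<and> M \<le> real (m + 1) * \<delta> ^ m" for m
  proof -
    have "(\<Sum>k<N. real (k choose m) * p k) \<le> real (m + 1) * \<delta> ^ m" for N
    proof (rule LIMSEQ_le_const2)
      show "(\<lambda>n. \<Sum>k<N. real (k choose m) * y n k) \<longlonglongrightarrow> (\<Sum>k<N. real (k choose m) * p k)"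
        by (intro tendsto_intros lim)
      have "(\<Sum>k<N. real (k choose m) * y n k) \<le> real (m + 1) * \<delta> ^ m" for n
      proof -
        obtain M where "((\<lambda>k. real (k choose m) * y n k) has_sum M) UNIV" "M \<le> real (m + 1) * \<delta> ^ m"
          using yn(4) by blast
        then show ?thesis
          using finite_sum_le_has_sum[where f = "\<lambda>k. real (k choose m) * y n k" and A = UNIV and B = "{..<N}"] yn(1) by force
      qed
      then show "\<exists>N'. \<forall>n\<ge>N'. (\<Sum>k<N. real (k choose m) * y n k) \<le> real (m + 1) * \<delta> ^ m"
        by blast
    qed
    then have "summable (\<lambda>k. real (k choose m) * p k)" "(\<Sum>k. real (k choose m) * p k) \<le> real (m + 1) * \<delta> ^ m"
      using p by (auto intro!: summableI_nonneg_bounded suminf_le_const)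
    then show ?thesis
      using p by (auto simp: has_sum_UNIV_iff_sums intro!: exI[of _ "\<Sum>k. real (k choose m) * p k"])
  qed
  show ?thesis
    using p mass mean mom by (simp add: Pad_iff[OF \<alpha>] has_sum_UNIV_iff_sums)
qed

subsection \<open>Fixed points\<close>

lemma has_sum_finite_support_iff:
  fixes f :: "nat \<Rightarrow> real"
  assumes "\<And>k. N < k \<Longrightarrow> f k = 0"
  shows "(f has_sum s) UNIV \<longleftrightarrow> s = (\<Sum>k\<le>N. f k)"
proof -
  have "(f has_sum s) UNIV \<longleftrightarrow> (f has_sum s) {..N}"
    by (rule has_sum_cong_neutral) (use assms in auto)
  then show ?thesis
    by (simp add: has_sum_finite_iff)
qed

lemma sum_atMost_split_ends:
  fixes f :: "nat \<Rightarrow> real"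
  assumes "1 \<le> N"
  shows "(\<Sum>k\<le>N. f k) = f 0 + (\<Sum>k=1..<N. f k) + f N"
proof -
  have "{..N} = insert 0 (insert N {1..<N})"
    using assms by auto
  then show ?thesis
    using assms by simp
qed

context crossover_kernel
begin

lemma bilin_finite_support:
  assumes "\<And>k. N < k \<Longrightarrow> p k = 0"
  shows "bilin K p p i = (\<Sum>k\<le>N. \<Sum>l\<le>N. K k l i * (p k * p l))"
proof -
  have "bilin K p p i = (\<Sum>\<^sub>\<infinity>(k,l)\<in>{..N}\<times>{..N}. K k l i * (p k * p l))"
    unfolding bilin_def
  proof (rule infsum_cong_neutral)
    fix kl assume "kl \<in> UNIV - {..N} \<times> {..N}"
    then show "(case kl of (k,l) \<Rightarrow> K k l i * (p k * p l)) = 0"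
      using assms by (cases kl) (auto simp: not_le)
  qed auto
  then show ?thesis
    by (simp add: sum.cartesian_product)
qed

text \<open>At a fixed point the moment inequality reads \<open>(m - 1) a m \<le> (\<Sum>n=1..<m. a n * a (m - n))\<close>,
  so all moments are bounded in terms of the mean alone.\<close>
lemma fixed_point_in_Pad:
  assumes \<alpha>: "0 < \<alpha>" "\<alpha> \<le> \<delta>" and nn: "\<And>k. 0 \<le> p k" and supp: "\<And>k. N < k \<Longrightarrow> p k = 0"
    and mass: "(\<Sum>k\<le>N. p k) = 1" and mean: "(\<Sum>k\<le>N. real k * p k) = 2 * \<alpha>"
    and fp: "bilin K p p = p"
  shows "p \<in> Pad \<alpha> \<delta>"
proof -
  define M where "M m = (\<Sum>k\<le>N. real (k choose m) * p k)" for m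
  define a where "a m = M m / real (m + 1)" for m
  have M: "((\<lambda>k. real (k choose m) * p k) has_sum M m) UNIV" for m
    using supp by (subst has_sum_finite_support_iff[of N]) (auto simp: M_def)
  have a_nonneg: "0 \<le> a m" for m
    by (simp add: a_def M_def sum_nonneg nn)
  have rec: "real (m + 1) * a m \<le> (\<Sum>n\<le>m. a n * a (m - n))" for m
  proof -
    obtain G where G: "((\<lambda>i. real (i choose m) * bilin K p p i) has_sum G) UNIV"
      "G \<le> (\<Sum>n\<le>m. M n / real (n + 1) * (M (m - n) / real (m - n + 1)))"
      by (rule bilin_choose[of p m M]) (use nn M in auto)
    moreover have "G = M m"
      using has_sum_unique[OF G(1)] M[of m] by (simp add: fp)
    ultimately show ?thesis
      by (simp add: a_def)
  qed
  have a_le: "a m \<le> \<alpha> ^ m" for m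
  proof (induction m rule: less_induct)
    case (less m)
    consider "m = 0" | "m = 1" | "2 \<le> m" by linarith
    then show ?case
    proof cases
      case 3
      have "real (m + 1) * a m \<le> 2 * a m + (\<Sum>n=1..<m. a n * a (m - n))"
        using rec[of m] sum_atMost_split_ends[of m "\<lambda>n. a n * a (m - n)"] 3 mass
        by (simp add: a_def M_def)
      also have "(\<Sum>n=1..<m. a n * a (m - n)) \<le> (\<Sum>n=1..<m. \<alpha> ^ n * \<alpha> ^ (m - n))"
        using less \<alpha> a_nonneg by (intro sum_mono mult_mono) auto
      also have "\<dots> = real (m - 1) * \<alpha> ^ m"
        by (simp flip: power_add)
      finally have "real (m - 1) * a m \<le> real (m - 1) * \<alpha> ^ m"
        using 3 by (simp add: algebra_simps of_nat_diff)
      then show ?thesis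
        using 3 by simp
    qed (use mass mean in \<open>auto simp: a_def M_def\<close>)
  qed
  have "M m \<le> real (m + 1) * \<delta> ^ m" for m
  proof -
    have "M m = real (m + 1) * a m"
      by (simp add: a_def)
    also have "\<dots> \<le> real (m + 1) * \<delta> ^ m"
      using a_le[of m] power_mono[of \<alpha> \<delta> m] \<alpha> by (intro mult_left_mono) auto
    finally show ?thesis .
  qed
  moreover have "(p has_sum 1) UNIV" "((\<lambda>k. real k * p k) has_sum 2 * \<alpha>) UNIV"
    using supp mass mean by (simp_all add: has_sum_finite_support_iff[of N])
  ultimately show ?thesis
    using nn M by (auto simp: Pad_iff[OF \<alpha>(2)])
qed

text \<open>A law on \<open>{0..N}\<close> with mean \<open>\<mu>\<close> is determined by its values at \<open>1, \<dots>, N - 1\<close>, which can be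
  arbitrary nonnegative numbers subject to two linear inequalities. Rescaling by \<open>c\<close> retracts the cube
  onto this set.\<close>
lemma exists_fixed_point_finite_support:
  assumes trunc: "\<And>k l i. k \<le> N \<Longrightarrow> l \<le> N \<Longrightarrow> N < i \<Longrightarrow> K k l i = 0"
    and \<mu>: "0 < \<mu>" "\<mu> < real N"
  obtains p where "\<And>k. 0 \<le> p k" "\<And>k. N < k \<Longrightarrow> p k = 0" "(\<Sum>k\<le>N. p k) = 1"
    "(\<Sum>k\<le>N. real k * p k) = \<mu>" "bilin K p p = p"
proof -
  have N: "1 \<le> N"
    using \<mu> by linarith
  define m1 where "m1 x = (\<Sum>k=1..<N. real k * x k)" for x :: "nat \<Rightarrow> real"
  define m2 where "m2 x = (\<Sum>k=1..<N. (real N - real k) * x k)" for x :: "nat \<Rightarrow> real"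
  define c where "c x = 1 / max 1 (max (m1 x / \<mu>) (m2 x / (real N - \<mu>)))" for x
  define P where "P x k = (if k = 0 then (real N - \<mu> - c x * m2 x) / real N
      else if k < N then c x * x k else if k = N then (\<mu> - c x * m1 x) / real N else 0)" for x k
  define F where "F x i = (if i = 0 then 0 else \<Sum>k\<le>N. \<Sum>l\<le>N. K k l i * (P x k * P x l))" for x i
  have c_pos: "0 < c x" for x
    by (simp add: c_def less_max_iff_disj)
  have c_m1: "c x * m1 x \<le> \<mu>" for x
  proof -
    have "m1 x / \<mu> \<le> max 1 (max (m1 x / \<mu>) (m2 x / (real N - \<mu>)))"
      by simp
    then have "m1 x \<le> max 1 (max (m1 x / \<mu>) (m2 x / (real N - \<mu>))) * \<mu>"
      using \<mu> by (simp only: pos_divide_le_eq)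
    then show ?thesis
      by (simp add: c_def pos_divide_le_eq less_max_iff_disj mult.commute)
  qed
  have c_m2: "c x * m2 x \<le> real N - \<mu>" for x
  proof -
    have "0 < real N - \<mu>"
      using \<mu> by simp
    moreover have "m2 x / (real N - \<mu>) \<le> max 1 (max (m1 x / \<mu>) (m2 x / (real N - \<mu>)))"
      by simp
    ultimately have "m2 x \<le> max 1 (max (m1 x / \<mu>) (m2 x / (real N - \<mu>))) * (real N - \<mu>)"
      by (simp only: pos_divide_le_eq)
    then show ?thesis
      by (simp add: c_def pos_divide_le_eq less_max_iff_disj mult.commute)
  qed
  have P_interior: "(\<Sum>k=1..<N. f k * P x k) = c x * (\<Sum>k=1..<N. f k * x k)" for f x
    unfolding sum_distrib_left by (intro sum.cong) (auto simp: P_def)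
  have m12: "m1 x + m2 x = real N * (\<Sum>k=1..<N. x k)" for x
    by (simp add: m1_def m2_def sum_distrib_left sum.distrib[symmetric] algebra_simps)
  have P_nonneg: "0 \<le> P x k" if "x \<in> nat_cube N" for x k
    using c_m1[of x] c_m2[of x] c_pos[of x] that by (auto simp: P_def nat_cube_def)
  have P_supp: "N < k \<Longrightarrow> P x k = 0" for x k
    by (simp add: P_def)
  have P_mass: "(\<Sum>k\<le>N. P x k) = 1" for x
  proof -
    have "(\<Sum>k\<le>N. P x k) = (real N - \<mu> - c x * m2 x) / real N + c x * (\<Sum>k=1..<N. x k)
        + (\<mu> - c x * m1 x) / real N"
      using P_interior[of "\<lambda>_. 1" x] N by (simp add: sum_atMost_split_ends) (simp add: P_def)
    also have "\<dots> = (real N - c x * (m1 x + m2 x) + c x * (real N * (\<Sum>k=1..<N. x k))) / real N"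
      using N by (simp add: field_simps)
    also have "\<dots> = 1"
      unfolding m12 using N by simp
    finally show ?thesis .
  qed
  have P_mean: "(\<Sum>k\<le>N. real k * P x k) = \<mu>" for x
  proof -
    have "(\<Sum>k\<le>N. real k * P x k) = c x * m1 x + real N * P x N"
      using P_interior[of real x] N by (simp add: sum_atMost_split_ends m1_def)
    also have "real N * P x N = \<mu> - c x * m1 x"
      using N by (simp add: P_def)
    finally show ?thesis by simp
  qed
  have Q: "\<And>i. 0 \<le> bilin K (P x) (P x) i" "\<And>i. N < i \<Longrightarrow> bilin K (P x) (P x) i = 0"
    "(\<Sum>i\<le>N. bilin K (P x) (P x) i) = 1" "(\<Sum>i\<le>N. real i * bilin K (P x) (P x) i) = \<mu>"
    if x: "x \<in> nat_cube N" for x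
  proof -
    have mass: "(P x has_sum 1) UNIV" and mean: "((\<lambda>k. real k * P x k) has_sum \<mu>) UNIV"
      using P_supp P_mass P_mean by (simp_all add: has_sum_finite_support_iff[of N])
    show "0 \<le> bilin K (P x) (P x) i" for i
      by (intro bilin_nonneg P_nonneg x)
    show supp: "bilin K (P x) (P x) i = 0" if "N < i" for i
      using that by (simp add: bilin_finite_support[OF P_supp] trunc)
    show "(\<Sum>i\<le>N. bilin K (P x) (P x) i) = 1"
      using bilin_mass(1)[OF P_nonneg P_nonneg mass mass] x supp
      by (simp add: has_sum_finite_support_iff[of N])
    show "(\<Sum>i\<le>N. real i * bilin K (P x) (P x) i) = \<mu>"
      using bilin_mean[OF P_nonneg mass mean] x supp
      by (simp add: has_sum_finite_support_iff[of N])
  qed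
  have F_eq: "F x i = (if i = 0 then 0 else bilin K (P x) (P x) i)" for x i
    by (simp add: F_def bilin_finite_support[OF P_supp])
  have coord: "continuous_on S (\<lambda>x :: nat \<Rightarrow> real. x k)" for S k
    by (rule continuous_on_subset[OF continuous_on_product_coordinates]) simp
  have c_cont: "continuous_on S c" and m_cont: "continuous_on S m1" "continuous_on S m2" for S
  proof -
    show m: "continuous_on S m1" "continuous_on S m2"
      unfolding m1_def m2_def by (intro continuous_intros coord)+
    have "max 1 (max (m1 x / \<mu>) (m2 x / (real N - \<mu>))) \<noteq> 0" for x
      by (metis max.cobounded1 not_one_le_zero)
    then show "continuous_on S c"
      unfolding c_def using \<mu> by (intro continuous_intros m) auto
  qed
  have P_cont: "continuous_on S (\<lambda>x. P x k)" for S k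
  proof -
    consider "k = 0" | "0 < k" "k < N" | "0 < k" "k = N" | "N < k" by linarith
    then show ?thesis
      using N by cases (auto simp: P_def intro!: continuous_intros c_cont m_cont coord)
  qed
  obtain x where x: "x \<in> nat_cube N" and fix_x: "\<And>i. i < N \<Longrightarrow> F x i = x i"
  proof (rule brouwer_nat_cube[of N F])
    fix i
    show "continuous_on (nat_cube N) (\<lambda>x. F x i)"
      by (cases "i = 0") (auto simp: F_def intro!: continuous_intros P_cont)
    fix x assume x: "x \<in> nat_cube N" and i: "i < N"
    have "bilin K (P x) (P x) i \<le> (\<Sum>i\<le>N. bilin K (P x) (P x) i)"
      using i Q(1)[OF x] by (intro member_le_sum) auto
    then show "0 \<le> F x i \<and> F x i \<le> 1"
      using Q(1,3)[OF x] by (simp add: F_eq)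
  qed blast
  define y where "y = bilin K (P x) (P x)"
  have y: "\<And>i. 0 \<le> y i" "\<And>i. N < i \<Longrightarrow> y i = 0" "(\<Sum>i\<le>N. y i) = 1" "(\<Sum>i\<le>N. real i * y i) = \<mu>"
    using Q[OF x] by (simp_all add: y_def)
  have yx: "y i = x i" if "i \<in> {1..<N}" for i
    using fix_x[of i] that by (simp add: F_eq y_def)
  have m1: "m1 x + real N * y N = \<mu>"
    using y(4) N yx by (simp add: sum_atMost_split_ends m1_def)
  have m2: "m2 x + real N * y 0 = real N - \<mu>"
  proof -
    have "m1 x + m2 x = real N * (\<Sum>k=1..<N. y k)"
      using yx by (simp add: m12)
    also have "\<dots> = real N * (1 - y 0 - y N)"
      using y(3) N by (simp add: sum_atMost_split_ends)
    finally show ?thesis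
      using m1 by (simp add: algebra_simps)
  qed
  have "m1 x / \<mu> \<le> 1" "m2 x / (real N - \<mu>) \<le> 1"
    using m1 m2 mult_nonneg_nonneg[OF of_nat_0_le_iff y(1)[of N], of N]
      mult_nonneg_nonneg[OF of_nat_0_le_iff y(1)[of 0], of N] \<mu> by simp_all
  then have "c x = 1"
    by (simp add: c_def)
  have "P x k = y k" for k
  proof -
    consider "k = 0" | "k \<in> {1..<N}" | "k = N" "0 < k" | "N < k"
      by fastforce
    then show ?thesis
    proof cases
      case 1
      then show ?thesis using m2 \<open>c x = 1\<close> N by (simp add: P_def field_simps)
    next
      case 3
      then show ?thesis using m1 \<open>c x = 1\<close> N by (simp add: P_def field_simps)
    qed (use \<open>c x = 1\<close> yx y(2) in \<open>auto simp: P_def\<close>)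
  qed
  then have "P x = y" ..
  then have "bilin K y y = y"
    by (simp add: y_def)
  with y show ?thesis
    by (rule that)
qed

end

text \<open>Forbidding \<open>max i j > N\<close> whenever \<open>k, l \<le> N\<close> makes \<open>{0..N}\<close> invariant, and the weight remains
  increasing in \<open>min i j\<close>.\<close>
definition trunc_ker :: "real \<Rightarrow> nat \<Rightarrow> nat \<Rightarrow> nat \<Rightarrow> nat \<Rightarrow> real" where
  "trunc_ker q N k l =
    cross_ker k l (\<lambda>u. if k \<le> N \<and> l \<le> N \<and> N + u < k + l then 0 else q ^ (min k l - u))"

lemma crossover_kernel_trunc_ker:
  assumes "0 \<le> q" "q \<le> 1"
  shows "crossover_kernel (trunc_ker q N)"
  unfolding trunc_ker_def
proof (rule crossover_kernel_cross_ker)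
  fix k l
  show "mono (\<lambda>u. if k \<le> N \<and> l \<le> N \<and> N + u < k + l then 0 else q ^ (min k l - u))"
    using assms by (auto simp: mono_def intro: power_decreasing)
qed (use assms in auto)

lemma trunc_ker_eq: "k + l \<le> N \<Longrightarrow> trunc_ker q N k l = uc_ker q k l"
  by (auto simp: trunc_ker_def uc_ker_def)

lemma trunc_ker_eq_0: "k \<le> N \<Longrightarrow> l \<le> N \<Longrightarrow> N < i \<Longrightarrow> trunc_ker q N k l i = 0"
  by (auto simp: trunc_ker_def cross_ker_def cross_weight_def)

lemma exists_fixed_point_recomb:
  assumes q: "0 \<le> q" "q \<le> 1" and \<alpha>: "0 < \<alpha>" "\<alpha> \<le> \<delta>"
  shows "\<exists>p\<in>Pad \<alpha> \<delta>. recomb q p = p"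
proof -
  interpret uc: crossover_kernel "uc_ker q"
    by (rule crossover_kernel_uc_ker[OF q])
  obtain N0 :: nat where N0: "2 * \<alpha> < real N0"
    using reals_Archimedean2 by blast
  have "\<exists>p. p \<in> Pad \<alpha> \<delta> \<and> bilin (trunc_ker q (N0 + j)) p p = p" for j
  proof -
    interpret tr: crossover_kernel "trunc_ker q (N0 + j)"
      by (rule crossover_kernel_trunc_ker[OF q])
    obtain p where "\<And>k. 0 \<le> p k" "\<And>k. N0 + j < k \<Longrightarrow> p k = 0" "(\<Sum>k\<le>N0 + j. p k) = 1"
        "(\<Sum>k\<le>N0 + j. real k * p k) = 2 * \<alpha>" "bilin (trunc_ker q (N0 + j)) p p = p"
      by (rule tr.exists_fixed_point_finite_support[of "N0 + j" "2 * \<alpha>"])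
        (use N0 \<alpha> in \<open>auto simp: trunc_ker_eq_0\<close>)
    then show ?thesis
      using tr.fixed_point_in_Pad[OF \<alpha>, of p "N0 + j"] by blast
  qed
  then obtain P where P: "\<And>j. P j \<in> Pad \<alpha> \<delta>" "\<And>j. bilin (trunc_ker q (N0 + j)) (P j) (P j) = P j"
    by metis
  have P_nonneg: "0 \<le> P j k" and P_mass: "(P j has_sum 1) UNIV" for j k
    using P(1)[of j] by (simp_all add: Pad_iff[OF \<alpha>(2)])
  have "norm (P j k) \<le> 1" for j k
    using finite_sum_le_has_sum[OF P_mass, of "{k}" j] P_nonneg by simp
  then obtain r where r: "strict_mono r" and "\<And>k. \<exists>l. (\<lambda>j. P (r j) k) \<longlonglongrightarrow> l"
    by - (rule function_convergent_subsequence[of UNIV P 1], auto)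
  then obtain p where p: "\<And>k. (\<lambda>j. P (r j) k) \<longlonglongrightarrow> p k"
    by metis
  have pPad: "p \<in> Pad \<alpha> \<delta>"
    by (rule Pad_closed[OF \<alpha>(2) _ p]) (rule P)
  then have p_nonneg: "\<And>k. 0 \<le> p k" and p_mass: "(p has_sum 1) UNIV"
    by (simp_all add: Pad_iff[OF \<alpha>(2)])
  have le: "bilin (uc_ker q) p p i \<le> p i" for i
    unfolding bilin_def
  proof (rule infsum_le_finite_sums)
    show "(\<lambda>(k,l). uc_ker q k l i * (p k * p l)) summable_on UNIV"
      by (rule uc.bilin_mass(2)[OF p_nonneg p_nonneg p_mass p_mass])
    fix A :: "(nat \<times> nat) set" assume A: "finite A"
    define B where "B = (\<Sum>(k,l)\<in>A. k + l)"
    have B: "k + l \<le> B" if "(k, l) \<in> A" for k l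
      using member_le_sum[of "(k, l)" A "\<lambda>(k,l). k + l"] that A by (simp add: B_def)
    have "(\<Sum>(k,l)\<in>A. uc_ker q k l i * (P (r j) k * P (r j) l)) \<le> P (r j) i" if "B \<le> j" for j
    proof -
      interpret tr: crossover_kernel "trunc_ker q (N0 + r j)"
        by (rule crossover_kernel_trunc_ker[OF q])
      have "B \<le> r j"
        using seq_suble[OF r, of j] that by simp
      then have "(\<Sum>(k,l)\<in>A. uc_ker q k l i * (P (r j) k * P (r j) l)) =
          (\<Sum>(k,l)\<in>A. trunc_ker q (N0 + r j) k l i * (P (r j) k * P (r j) l))"
        using B by (intro sum.cong refl) (fastforce simp: trunc_ker_eq)
      also have "\<dots> \<le> bilin (trunc_ker q (N0 + r j)) (P (r j)) (P (r j)) i"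
        unfolding bilin_def
        by (intro finite_sum_le_infsum tr.bilin_mass(2)[OF P_nonneg P_nonneg P_mass P_mass] A)
          (auto simp: tr.K_nonneg P_nonneg)
      finally show ?thesis
        by (simp add: P)
    qed
    then show "(\<Sum>(k,l)\<in>A. uc_ker q k l i * (p k * p l)) \<le> p i"
      unfolding case_prod_unfold
      by (intro LIMSEQ_le[OF tendsto_sum[OF tendsto_mult[OF tendsto_const tendsto_mult[OF p p]]] p]) blast
  qed
  have "(bilin (uc_ker q) p p has_sum 1) UNIV"
    using uc.bilin_mass(1)[OF p_nonneg p_nonneg p_mass p_mass] by simp
  then have "((\<lambda>i. p i - bilin (uc_ker q) p p i) has_sum 0) UNIV"
    using has_sum_add[OF p_mass, of "\<lambda>i. - bilin (uc_ker q) p p i" "-1"] by (simp add: has_sum_uminus)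
  then have "p i - bilin (uc_ker q) p p i = 0" for i
    by (rule nonneg_has_sum_le_0D) (use le in auto)
  then have "recomb q p = p"
    using norm1_Pad[OF pPad] by (simp add: fun_eq_iff recomb_eq_bilin)
  with pPad show ?thesis by blast
qed

subsection \<open>Continuous time\<close>

lemma l1_add: "x \<in> l1 \<Longrightarrow> y \<in> l1 \<Longrightarrow> (\<lambda>k. x k + y k) \<in> l1"
  unfolding l1_def mem_Collect_eq
  by (rule summable_comparison_test'[of "\<lambda>k. \<bar>x k\<bar> + \<bar>y k\<bar>" 0]) (auto intro: summable_add)

lemma l1_cmult: "x \<in> l1 \<Longrightarrow> (\<lambda>k. c * x k) \<in> l1"
  unfolding l1_def by (auto simp: abs_mult intro: summable_mult)

lemma l1_diff: "x \<in> l1 \<Longrightarrow> y \<in> l1 \<Longrightarrow> (\<lambda>k. x k - y k) \<in> l1"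
  using l1_add[of x "\<lambda>k. (-1) * y k"] l1_cmult[of y "-1"] by simp

lemma norm1_nonneg: "x \<in> l1 \<Longrightarrow> 0 \<le> norm1 x"
  unfolding l1_def norm1_def by (auto intro: suminf_nonneg)

lemma norm1_add_le: "x \<in> l1 \<Longrightarrow> y \<in> l1 \<Longrightarrow> norm1 (\<lambda>k. x k + y k) \<le> norm1 x + norm1 y"
  using l1_add[of x y] unfolding norm1_def l1_def mem_Collect_eq
  by (subst suminf_add) (auto intro!: suminf_le summable_add)

lemma norm1_cmult: "x \<in> l1 \<Longrightarrow> norm1 (\<lambda>k. c * x k) = \<bar>c\<bar> * norm1 x"
  unfolding norm1_def l1_def by (simp add: abs_mult suminf_mult)

lemma norm1_minus_commute: "norm1 (\<lambda>k. x k - y k) = norm1 (\<lambda>k. y k - x k)"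
  by (simp add: norm1_def abs_minus_commute)

lemma has_sum_norm1: "x \<in> l1 \<Longrightarrow> ((\<lambda>k. \<bar>x k\<bar>) has_sum norm1 x) UNIV"
  unfolding l1_def norm1_def by (simp add: has_sum_UNIV_iff_sums summable_sums)

lemma abs_le_norm1: "x \<in> l1 \<Longrightarrow> \<bar>x k\<bar> \<le> norm1 x"
  unfolding l1_def norm1_def using sum_le_suminf[of "\<lambda>k. \<bar>x k\<bar>" "{k}"] by simp

lemma norm1_pos: "x \<in> l1 \<Longrightarrow> x \<noteq> (\<lambda>_. 0) \<Longrightarrow> 0 < norm1 x"
  using abs_le_norm1[of x] by (metis order.strict_trans2 zero_less_abs_iff)

lemma abs_norm1_diff_le:
  assumes "x \<in> l1" "y \<in> l1"
  shows "\<bar>norm1 x - norm1 y\<bar> \<le> norm1 (\<lambda>k. x k - y k)"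
  using norm1_add_le[OF assms(2) l1_diff[OF assms]] norm1_add_le[OF assms(1) l1_diff[OF assms(2,1)]]
  by (simp add: norm1_minus_commute[of x y])

context crossover_kernel
begin

lemma bilin_l1:
  assumes x: "x \<in> l1" and y: "y \<in> l1"
  shows bilin_abs_summable: "(\<lambda>kl. norm (case kl of (k,l) \<Rightarrow> K k l i * (x k * y l))) summable_on UNIV"
    and bilin_in_l1: "bilin K x y \<in> l1"
    and norm1_bilin_le: "norm1 (bilin K x y) \<le> norm1 x * norm1 y"
proof -
  let ?b = "bilin K (\<lambda>k. \<bar>x k\<bar>) (\<lambda>k. \<bar>y k\<bar>)"
  have abs: "norm (case kl of (k,l) \<Rightarrow> K k l i * (x k * y l)) =
      (case kl of (k,l) \<Rightarrow> K k l i * (\<bar>x k\<bar> * \<bar>y l\<bar>))" for kl i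
    by (simp add: abs_mult K_nonneg split: prod.split)
  note mass = bilin_mass[OF abs_ge_zero abs_ge_zero has_sum_norm1[OF x] has_sum_norm1[OF y]]
  show s: "(\<lambda>kl. norm (case kl of (k,l) \<Rightarrow> K k l i * (x k * y l))) summable_on UNIV" for i
    unfolding abs by (rule mass(2))
  have le: "\<bar>bilin K x y i\<bar> \<le> ?b i" for i
    using norm_infsum_bound[OF s[of i]] unfolding abs by (simp add: bilin_def)
  have b: "?b sums (norm1 x * norm1 y)"
    by (rule has_sum_imp_sums[OF mass(1)])
  have in_l1: "bilin K x y \<in> l1"
    unfolding l1_def mem_Collect_eq
    by (rule summable_comparison_test'[of ?b 0]) (use b le in \<open>auto simp: sums_iff\<close>)
  then show "bilin K x y \<in> l1" .
  have "norm1 (bilin K x y) \<le> (\<Sum>i. ?b i)"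
    using in_l1 b le unfolding norm1_def l1_def by (intro suminf_le) (auto simp: sums_iff)
  then show "norm1 (bilin K x y) \<le> norm1 x * norm1 y"
    using b by (simp add: sums_iff)
qed

lemma bilin_diff:
  assumes x: "x \<in> l1" and y: "y \<in> l1"
  shows "bilin K x x i - bilin K y y i =
    bilin K x (\<lambda>k. x k - y k) i + bilin K (\<lambda>k. x k - y k) y i"
proof -
  note d = l1_diff[OF x y]
  have s: "((\<lambda>kl. case kl of (k,l) \<Rightarrow> K k l i * (u k * v l)) has_sum bilin K u v i) UNIV"
    if "u \<in> l1" "v \<in> l1" for u v
    unfolding bilin_def by (rule has_sum_infsum[OF abs_summable_summable[OF bilin_abs_summable[OF that]]])
  have "((\<lambda>kl. (case kl of (k,l) \<Rightarrow> K k l i * (x k * (x l - y l))) +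
        (case kl of (k,l) \<Rightarrow> K k l i * ((x k - y k) * y l)) +
        (case kl of (k,l) \<Rightarrow> K k l i * (y k * y l))) has_sum
      bilin K x (\<lambda>k. x k - y k) i + bilin K (\<lambda>k. x k - y k) y i + bilin K y y i) UNIV"
    by (intro has_sum_add s x y d)
  also have "(\<lambda>kl. (case kl of (k,l) \<Rightarrow> K k l i * (x k * (x l - y l))) +
        (case kl of (k,l) \<Rightarrow> K k l i * ((x k - y k) * y l)) +
        (case kl of (k,l) \<Rightarrow> K k l i * (y k * y l))) =
      (\<lambda>kl. case kl of (k,l) \<Rightarrow> K k l i * (x k * x l))"
    by (auto simp: fun_eq_iff algebra_simps)
  finally have "bilin K x x i =
      bilin K x (\<lambda>k. x k - y k) i + bilin K (\<lambda>k. x k - y k) y i + bilin K y y i"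
    by (rule has_sum_unique[OF s[OF x x]])
  then show ?thesis by simp
qed

lemma normalized_bilin_lipschitz:
  assumes x: "x \<in> l1" "0 < norm1 x" and y: "y \<in> l1" "0 < norm1 y"
  shows "norm1 (\<lambda>i. bilin K x x i / norm1 x - bilin K y y i / norm1 y) \<le> 3 * norm1 (\<lambda>k. x k - y k)"
  using assms
proof (induction "norm1 x" "norm1 y" arbitrary: x y rule: linorder_wlog)
  case (sym x y)
  then show ?case
    by (subst (1 2) norm1_minus_commute) blast
next
  case (le y x)
  define d where "d = (\<lambda>k. x k - y k)"
  have d: "d \<in> l1"
    unfolding d_def using le by (intro l1_diff)
  have flip: "norm1 (\<lambda>k. y k - x k) = norm1 d"
    unfolding d_def by (rule norm1_minus_commute)
  define a where "a = (\<lambda>i. (1 / norm1 x) * (bilin K x d i + bilin K d y i))"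
  define b where "b = (\<lambda>i. (1 / norm1 x - 1 / norm1 y) * bilin K y y i)"
  have ab: "a \<in> l1" "b \<in> l1"
    unfolding a_def b_def using le d by (auto intro!: l1_cmult l1_add bilin_in_l1 simp del: times_divide_eq_left)
  have "norm1 a \<le> (1 / norm1 x) * (norm1 x * norm1 d + norm1 d * norm1 y)"
  proof -
    have "norm1 (\<lambda>i. bilin K x d i + bilin K d y i) \<le> norm1 (bilin K x d) + norm1 (bilin K d y)"
      using le d by (intro norm1_add_le bilin_in_l1)
    also have "\<dots> \<le> norm1 x * norm1 d + norm1 d * norm1 y"
      using le d by (intro add_mono norm1_bilin_le)
    finally have "(1 / norm1 x) * norm1 (\<lambda>i. bilin K x d i + bilin K d y i) \<le>
        (1 / norm1 x) * (norm1 x * norm1 d + norm1 d * norm1 y)"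
      using le by (intro mult_left_mono) auto
    moreover have "norm1 a = (1 / norm1 x) * norm1 (\<lambda>i. bilin K x d i + bilin K d y i)"
      unfolding a_def using le d by (subst norm1_cmult) (auto intro!: l1_add bilin_in_l1)
    ultimately show ?thesis
      by (simp only:)
  qed
  also have "\<dots> \<le> 2 * norm1 d"
    using le mult_left_mono[OF le(1) norm1_nonneg[OF d]] by (simp add: field_simps)
  finally have a: "norm1 a \<le> 2 * norm1 d" .
  have "norm1 b \<le> \<bar>1 / norm1 x - 1 / norm1 y\<bar> * (norm1 y * norm1 y)"
    unfolding b_def using le
    by (subst norm1_cmult) (auto intro!: bilin_in_l1 mult_left_mono norm1_bilin_le)
  also have "\<bar>1 / norm1 x - 1 / norm1 y\<bar> = (norm1 x - norm1 y) / (norm1 x * norm1 y)"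
  proof -
    have "1 / norm1 x - 1 / norm1 y = - ((norm1 x - norm1 y) / (norm1 x * norm1 y))"
      using le by (simp add: field_simps)
    then show ?thesis
      using le by simp
  qed
  also have "\<dots> * (norm1 y * norm1 y) = (norm1 x - norm1 y) * (norm1 y / norm1 x)"
    using le by (simp add: field_simps)
  also have "\<dots> \<le> norm1 d * 1"
  proof (rule mult_mono)
    show "norm1 x - norm1 y \<le> norm1 d"
      using abs_norm1_diff_le[of x y] le unfolding d_def by simp
  qed (use le d norm1_nonneg in auto)
  finally have b: "norm1 b \<le> norm1 d" by simp
  have "(\<lambda>i. bilin K x x i / norm1 x - bilin K y y i / norm1 y) = (\<lambda>i. a i + b i)"
  proof
    fix i
    have "a i = (bilin K x x i - bilin K y y i) / norm1 x"
      using bilin_diff[of x y i] le by (simp add: a_def d_def)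
    then show "bilin K x x i / norm1 x - bilin K y y i / norm1 y = a i + b i"
      by (simp add: b_def algebra_simps diff_divide_distrib)
  qed
  then have "norm1 (\<lambda>i. bilin K x x i / norm1 x - bilin K y y i / norm1 y) \<le> 3 * norm1 d"
    using norm1_add_le[OF ab] a b by simp
  then show ?case
    unfolding flip by (subst norm1_minus_commute)
qed

end

lemma recomb_in_l1:
  assumes "0 \<le> q" "q \<le> 1" "x \<in> l1"
  shows "recomb q x \<in> l1"
proof -
  interpret crossover_kernel "uc_ker q"
    by (rule crossover_kernel_uc_ker[OF assms(1,2)])
  have "recomb q x = (\<lambda>i. (1 / norm1 x) * bilin (uc_ker q) x x i)"
    by (simp add: fun_eq_iff recomb_eq_bilin)
  then show ?thesis
    using assms by (simp only: l1_cmult bilin_in_l1)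
qed

lemma recomb_lipschitz:
  assumes q: "0 \<le> q" "q \<le> 1" and "x \<in> l1" "x \<noteq> (\<lambda>_. 0)" "y \<in> l1" "y \<noteq> (\<lambda>_. 0)"
  shows "norm1 (\<lambda>i. recomb q x i - recomb q y i) \<le> 3 * norm1 (\<lambda>k. x k - y k)"
  unfolding recomb_eq_bilin using assms
  by (intro crossover_kernel.normalized_bilin_lipschitz crossover_kernel_uc_ker norm1_pos)

lemma dini_gronwall_le_0:
  fixes d :: "real \<Rightarrow> real"
  assumes d0: "d 0 \<le> 0" and cont: "continuous_on {0..} d" and L: "0 \<le> L"
    and step: "\<And>t \<epsilon>. 0 \<le> t \<Longrightarrow> 0 < \<epsilon> \<Longrightarrow>
      \<exists>\<eta>>0. \<forall>h. 0 < h \<and> h < \<eta> \<longrightarrow> d (t + h) \<le> d t + h * (L * d t + \<epsilon>)"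
    and t: "0 \<le> t"
  shows "d t \<le> 0"
proof (rule ccontr)
  assume "\<not> d t \<le> 0"
  then have dt: "0 < d t" by simp
  define B where "B s = d t / 2 * exp ((L + 1) * (s - t))" for s
  have B_pos: "0 < B s" for s
    using dt by (simp add: B_def)
  have B_cont: "continuous_on {0..} B"
    unfolding B_def by (intro continuous_intros)
  define A where "A = {s. 0 \<le> s \<and> B s < d s}"
  have tA: "t \<in> A"
    using t dt by (simp add: A_def B_def)
  define \<tau> where "\<tau> = Inf A"
  have bdd: "bdd_below A"
    by (rule bdd_belowI[of _ 0]) (simp add: A_def)
  have \<tau>0: "0 \<le> \<tau>"
    unfolding \<tau>_def by (rule cInf_greatest) (use tA in \<open>auto simp: A_def\<close>)
  have below: "d s \<le> B s" if "0 \<le> s" "s < \<tau>" for s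
    using cInf_lower[OF _ bdd, of s] that by (force simp: A_def \<tau>_def)
  have at_\<tau>: "d \<tau> \<le> B \<tau>"
  proof (rule ccontr)
    assume *: "\<not> d \<tau> \<le> B \<tau>"
    then have "\<tau> \<noteq> 0"
      using d0 B_pos[of 0] by auto
    then have "0 < \<tau>" using \<tau>0 by simp
    have "continuous_on {0..} (\<lambda>s. d s - B s)"
      by (intro continuous_intros cont B_cont)
    then obtain r where r: "0 < r"
      "\<And>s. 0 \<le> s \<Longrightarrow> dist s \<tau> < r \<Longrightarrow> dist (d s - B s) (d \<tau> - B \<tau>) < d \<tau> - B \<tau>"
      using * \<tau>0 unfolding continuous_on_iff by (metis atLeast_iff diff_gt_0_iff_gt not_le)
    define s where "s = max 0 (\<tau> - r / 2)"
    have s: "0 \<le> s" "s < \<tau>" "dist s \<tau> < r"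
      using \<open>0 < \<tau>\<close> r(1) by (auto simp: s_def dist_real_def)
    show False
      using r(2)[OF s(1,3)] below[OF s(1,2)] by (simp add: dist_real_def)
  qed
  obtain \<eta> where \<eta>: "0 < \<eta>"
    "\<And>h. 0 < h \<Longrightarrow> h < \<eta> \<Longrightarrow> d (\<tau> + h) \<le> d \<tau> + h * (L * d \<tau> + B \<tau>)"
    using step[OF \<tau>0 B_pos[of \<tau>]] by blast
  obtain s where s: "s \<in> A" "s < \<tau> + \<eta>"
    using cInf_lessD[of A "\<tau> + \<eta>"] tA \<eta>(1) by (auto simp: \<tau>_def)
  have "\<tau> \<le> s"
    unfolding \<tau>_def by (rule cInf_lower[OF s(1) bdd])
  moreover have "s \<noteq> \<tau>"
    using s(1) at_\<tau> by (auto simp: A_def)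
  ultimately have h: "0 < s - \<tau>" "s - \<tau> < \<eta>"
    using s by auto
  have "d s \<le> d \<tau> + (s - \<tau>) * (L * d \<tau> + B \<tau>)"
    using \<eta>(2)[OF h] by simp
  also have "\<dots> \<le> B \<tau> + (s - \<tau>) * (L * B \<tau> + B \<tau>)"
    using h L at_\<tau> by (intro add_mono mult_left_mono) auto
  also have "\<dots> = B \<tau> * (1 + (L + 1) * (s - \<tau>))"
    by (simp add: algebra_simps)
  also have "\<dots> \<le> B \<tau> * exp ((L + 1) * (s - \<tau>))"
    using B_pos[of \<tau>] by (intro mult_left_mono exp_ge_add_one_self) auto
  also have "\<dots> = B s"
    by (simp add: B_def mult_exp_exp algebra_simps)
  finally show False
    using s(1) by (simp add: A_def)
qed

text \<open>The \<open>l1\<close> distance to the closed convex set \<open>Pad \<alpha> \<delta>\<close> satisfies a differential inequality,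
  because an Euler step \<open>(1 - h) y + h R(y)\<close> starting in that set stays in it.\<close>
lemma ode_Pad:
  fixes p :: "real \<Rightarrow> nat \<Rightarrow> real"
  assumes q: "0 \<le> q" "q \<le> 1" and \<alpha>: "0 < \<alpha>" "\<alpha> \<le> \<delta>" and p0: "p 0 \<in> Pad \<alpha> \<delta>"
    and p: "\<And>t. 0 \<le> t \<Longrightarrow> p t \<in> l1" "\<And>t. 0 \<le> t \<Longrightarrow> p t \<noteq> (\<lambda>_. 0)"
    and ode: "\<And>t. 0 \<le> t \<Longrightarrow> has_l1_deriv_on_halfline p (\<lambda>k. recomb q (p t) k - p t k) t"
    and t: "0 \<le> t"
  shows "p t \<in> Pad \<alpha> \<delta>"
proof -
  define d where "d s = (INF y\<in>Pad \<alpha> \<delta>. norm1 (\<lambda>k. p s k - y k))" for s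
  define V where "V s = (\<lambda>k. recomb q (p s) k - p s k)" for s
  define Q where "Q s u = (\<lambda>k. (p u k - p s k) / (u - s) - V s k)" for s u
  have V: "V s \<in> l1" if "0 \<le> s" for s
    unfolding V_def using that by (intro l1_diff recomb_in_l1 q p)
  have Q: "Q s u \<in> l1" if "0 \<le> s" "0 \<le> u" for s u
  proof -
    have "(\<lambda>k. (1 / (u - s)) * (p u k - p s k) - V s k) \<in> l1"
      using that by (intro l1_diff l1_cmult p V)
    then show ?thesis
      by (simp add: Q_def)
  qed
  have Q_lim: "((\<lambda>u. norm1 (Q s u)) \<longlongrightarrow> 0) (at s within {0..})" if "0 \<le> s" for s
    using ode[OF that] by (simp add: has_l1_deriv_on_halfline_def Q_def V_def)
  have dist_l1: "(\<lambda>k. p s k - y k) \<in> l1" if "0 \<le> s" "y \<in> Pad \<alpha> \<delta>" for s y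
    using that by (intro l1_diff p Pad_subset_l1)
  have bdd: "bdd_below ((\<lambda>y. norm1 (\<lambda>k. p s k - y k)) ` Pad \<alpha> \<delta>)" if "0 \<le> s" for s
    using that dist_l1 norm1_nonneg by (intro bdd_belowI2[of _ 0]) blast
  have d_le: "d s \<le> norm1 (\<lambda>k. p s k - y k)" if "0 \<le> s" "y \<in> Pad \<alpha> \<delta>" for s y
    unfolding d_def by (rule cINF_lower[OF bdd[OF that(1)] that(2)])
  have d_ge: "c \<le> d s" if "\<And>y. y \<in> Pad \<alpha> \<delta> \<Longrightarrow> c \<le> norm1 (\<lambda>k. p s k - y k)" for c s
    unfolding d_def by (rule cINF_greatest) (use p0 that in auto)
  have d_0: "d 0 \<le> 0"
    using d_le[OF order.refl p0] by (simp add: norm1_def)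
  have d_lip: "d u - d s \<le> norm1 (\<lambda>k. p u k - p s k)" if "0 \<le> s" "0 \<le> u" for s u
  proof -
    have "d u - norm1 (\<lambda>k. p u k - p s k) \<le> d s"
    proof (rule d_ge)
      fix y assume y: "y \<in> Pad \<alpha> \<delta>"
      have "d u \<le> norm1 (\<lambda>k. (p u k - p s k) + (p s k - y k))"
        using d_le[OF that(2) y] by simp
      also have "\<dots> \<le> norm1 (\<lambda>k. p u k - p s k) + norm1 (\<lambda>k. p s k - y k)"
        using that y by (intro norm1_add_le l1_diff dist_l1 p)
      finally show "d u - norm1 (\<lambda>k. p u k - p s k) \<le> norm1 (\<lambda>k. p s k - y k)"
        by simp
    qed
    then show ?thesis by simp
  qed
  have incr: "norm1 (\<lambda>k. p u k - p s k) \<le> \<bar>u - s\<bar> * (norm1 (Q s u) + norm1 (V s))" if "0 \<le> s" "0 \<le> u" for s u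
  proof (cases "u = s")
    case False
    have "norm1 (\<lambda>k. p u k - p s k) = norm1 (\<lambda>k. (u - s) * (Q s u k + V s k))"
      using False by (simp add: Q_def)
    also have "\<dots> = \<bar>u - s\<bar> * norm1 (\<lambda>k. Q s u k + V s k)"
      using that by (intro norm1_cmult l1_add Q V)
    also have "\<dots> \<le> \<bar>u - s\<bar> * (norm1 (Q s u) + norm1 (V s))"
      using that by (intro mult_left_mono norm1_add_le Q V) auto
    finally show ?thesis .
  qed (simp add: norm1_def)
  have d_cont: "continuous_on {0..} d"
    unfolding continuous_on_def
  proof
    fix s :: real assume s: "s \<in> {0..}"
    have "((\<lambda>u. \<bar>u - s\<bar> * (norm1 (Q s u) + norm1 (V s))) \<longlongrightarrow> \<bar>s - s\<bar> * (0 + norm1 (V s))) (at s within {0..})"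
      using s by (intro tendsto_intros Q_lim) auto
    then have lim: "((\<lambda>u. \<bar>u - s\<bar> * (norm1 (Q s u) + norm1 (V s))) \<longlongrightarrow> 0) (at s within {0..})"
      by simp
    have "\<bar>d u - d s\<bar> \<le> \<bar>u - s\<bar> * (norm1 (Q s u) + norm1 (V s))" if "u \<in> {0..}" for u
      using d_lip[of s u] d_lip[of u s] incr[of s u] s that norm1_minus_commute[of "p u" "p s"] by auto
    then have "\<forall>\<^sub>F u in at s within {0..}. norm (d u - d s) \<le> \<bar>u - s\<bar> * (norm1 (Q s u) + norm1 (V s))"
      by (auto simp: eventually_at_filter)
    then have "((\<lambda>u. d u - d s) \<longlongrightarrow> 0) (at s within {0..})"
      by (rule Lim_null_comparison[OF _ lim])
    then show "(d \<longlongrightarrow> d s) (at s within {0..})"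
      by (rule LIM_zero_cancel)
  qed
  have step: "\<exists>\<eta>>0. \<forall>h. 0 < h \<and> h < \<eta> \<longrightarrow> d (s + h) \<le> d s + h * (2 * d s + \<epsilon>)"
    if s: "0 \<le> s" and \<epsilon>: "0 < \<epsilon>" for s \<epsilon>
  proof -
    obtain \<eta> where \<eta>: "0 < \<eta>"
      "\<And>u. 0 \<le> u \<Longrightarrow> u \<noteq> s \<Longrightarrow> dist u s < \<eta> \<Longrightarrow> dist (norm1 (Q s u)) 0 < \<epsilon>"
      using tendstoD[OF Q_lim[OF s] \<epsilon>] unfolding eventually_at by auto
    have "d (s + h) \<le> d s + h * (2 * d s + \<epsilon>)" if h: "0 < h" "h < min \<eta> 1" for h
    proof -
      have Qh: "norm1 (Q s (s + h)) \<le> \<epsilon>"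
        using \<eta>(2)[of "s + h"] s h by (simp add: dist_real_def)
      have "(d (s + h) - h * \<epsilon>) / (1 + 2 * h) \<le> d s"
      proof (rule d_ge)
        fix y assume y: "y \<in> Pad \<alpha> \<delta>"
        define e where "e = (\<lambda>k. p s k - y k)"
        define f where "f = (\<lambda>k. recomb q (p s) k - recomb q y k)"
        have e: "e \<in> l1"
          unfolding e_def by (rule dist_l1[OF s y])
        have f: "f \<in> l1"
          unfolding f_def using s y by (intro l1_diff recomb_in_l1 q p Pad_subset_l1)
        have "y \<noteq> (\<lambda>_. 0)"
          using norm1_Pad[OF y] by (auto simp: norm1_def)
        then have f_le: "norm1 f \<le> 3 * norm1 e"
          unfolding f_def e_def using s y by (intro recomb_lipschitz q p Pad_subset_l1)
        have "(\<lambda>k. (1 - h) * y k + h * recomb q y k) \<in> Pad \<alpha> \<delta>"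
          using h y by (intro Pad_convex recomb_Pad q \<alpha>) auto
        then have "d (s + h) \<le> norm1 (\<lambda>k. p (s + h) k - ((1 - h) * y k + h * recomb q y k))"
          using s h by (intro d_le) auto
        also have "(\<lambda>k. p (s + h) k - ((1 - h) * y k + h * recomb q y k)) =
            (\<lambda>k. h * Q s (s + h) k + ((1 - h) * e k + h * f k))"
          using h by (simp add: fun_eq_iff Q_def V_def e_def f_def field_simps)
        also have "norm1 \<dots> \<le> norm1 (\<lambda>k. h * Q s (s + h) k) + (norm1 (\<lambda>k. (1 - h) * e k) + norm1 (\<lambda>k. h * f k))"
          using s h by (intro order.trans[OF norm1_add_le] add_left_mono norm1_add_le l1_add l1_cmult Q e f) auto
        also have "\<dots> = h * norm1 (Q s (s + h)) + ((1 - h) * norm1 e + h * norm1 f)"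
          using s h e f Q[of s "s + h"] by (simp add: norm1_cmult)
        also have "\<dots> \<le> h * \<epsilon> + ((1 - h) * norm1 e + h * (3 * norm1 e))"
          using h Qh f_le by (intro add_mono mult_left_mono) auto
        finally show "(d (s + h) - h * \<epsilon>) / (1 + 2 * h) \<le> norm1 (\<lambda>k. p s k - y k)"
          using h by (simp add: e_def[symmetric] divide_le_eq algebra_simps)
      qed
      then show ?thesis
        using h by (simp add: divide_le_eq algebra_simps)
    qed
    then show ?thesis
      using \<eta>(1) by (intro exI[of _ "min \<eta> 1"]) auto
  qed
  have "d t \<le> 0"
    by (rule dini_gronwall_le_0[OF d_0 d_cont _ step t]) simp
  have "\<exists>y\<in>Pad \<alpha> \<delta>. norm1 (\<lambda>k. p t k - y k) < 1 / real (Suc n)" for n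
  proof (rule ccontr)
    assume "\<not> ?thesis"
    then have "1 / real (Suc n) \<le> d t"
      by (intro d_ge) (auto simp: not_less)
    then show False
      using \<open>d t \<le> 0\<close> divide_pos_pos[of 1 "real (Suc n)"] by linarith
  qed
  then obtain y where y: "\<And>n. y n \<in> Pad \<alpha> \<delta>" "\<And>n. norm1 (\<lambda>k. p t k - y n k) < 1 / real (Suc n)"
    by metis
  show ?thesis
  proof (rule Pad_closed[OF \<alpha>(2) y(1)])
    fix k
    have "norm (y n k - p t k) \<le> 1 / real (Suc n)" for n
      using abs_le_norm1[OF dist_l1[OF t y(1)[of n]], of k] y(2)[of n] by (simp add: abs_minus_commute)
    then have "(\<lambda>n. y n k - p t k) \<longlonglongrightarrow> 0"
      by (intro Lim_null_comparison[OF _ LIMSEQ_Suc[OF lim_1_over_n]] always_eventually) auto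
    then show "(\<lambda>n. y n k) \<longlonglongrightarrow> p t k"
      by (rule LIM_zero_cancel)
  qed
qed

theorem theorem4:
  fixes q \<alpha> \<delta> :: real
  assumes "0 \<le> q" "q \<le> 1" "0 < \<alpha>" "\<alpha> \<le> \<delta>"
  shows "(\<forall>p :: nat \<Rightarrow> nat \<Rightarrow> real.
            p 0 \<in> Pad \<alpha> \<delta> \<and> (\<forall>t. p (Suc t) = recomb q (p t))
            \<longrightarrow> (\<forall>t. p t \<in> Pad \<alpha> \<delta>))
       \<and> (\<forall>p :: real \<Rightarrow> nat \<Rightarrow> real.
            p 0 \<in> Pad \<alpha> \<delta>
            \<and> (\<forall>t\<ge>0. p t \<in> l1 \<and> p t \<noteq> (\<lambda>_. 0)
                       \<and> has_l1_deriv_on_halfline p (\<lambda>k. recomb q (p t) k - p t k) t)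
            \<longrightarrow> (\<forall>t\<ge>0. p t \<in> Pad \<alpha> \<delta>))
       \<and> (\<exists>p \<in> Pad \<alpha> \<delta>. recomb q p = p)"
proof (intro conjI allI impI)
  fix p :: "nat \<Rightarrow> nat \<Rightarrow> real" and t
  assume p: "p 0 \<in> Pad \<alpha> \<delta> \<and> (\<forall>t. p (Suc t) = recomb q (p t))"
  show "p t \<in> Pad \<alpha> \<delta>"
    by (induction t) (use p recomb_Pad[OF assms] in auto)
next
  fix p :: "real \<Rightarrow> nat \<Rightarrow> real" and t :: real
  assume "p 0 \<in> Pad \<alpha> \<delta> \<and> (\<forall>t\<ge>0. p t \<in> l1 \<and> p t \<noteq> (\<lambda>_. 0)
      \<and> has_l1_deriv_on_halfline p (\<lambda>k. recomb q (p t) k - p t k) t)" "0 \<le> t"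
  then show "p t \<in> Pad \<alpha> \<delta>"
    using ode_Pad[OF assms, of p t] by blast
next
  show "\<exists>p\<in>Pad \<alpha> \<delta>. recomb q p = p"
    by (rule exists_fixed_point_recomb[OF assms])
qed

end
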